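(* For every integer $n\ge0$, \[ r_{24}(n)=(-1)^{n}\,64\left(\sum_{j=0}^{n}\sigma_5^{*}(j)\sigma_5^{*}(n-j)-\tau(n)\right)=(-1)^{n}\frac{512}{17}\left(\sum_{j=0}^{n}\sigma_3^{*}(j)\sigma_7^{*}(n-j)-\tau(n)\right). \]
   Context: $r_{24}(n)$ is the number of $(m_1,\dots,m_{24})\in\mathbb{Z}^{24}$ with $m_1^2+\cdots+m_{24}^2=n$. For $n,s\ge1$, $\sigma^{*}_{s}(n)=-\sum_{d\mid n}(-1)^{d}d^{s}$; by convention $\sigma^*_3(0)=-\frac1{16}$, $\sigma^*_5(0)=\frac18$, $\sigma^*_7(0)=-\frac{17}{32}$. Ramanujan's tau function is defined by $q\prod_{n\ge1}(1-q^n)^{24}=\sum_{n\ge1}\tau(n)q^n$, and $\tau(0)=0$. *)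

theory Defs
  imports "HOL-Analysis.Analysis"
begin

definition sum_squares_count :: "nat \<Rightarrow> nat \<Rightarrow> nat" where
  "sum_squares_count k n =
     card {m :: int list. length m = k \<and> (\<Sum>x\<leftarrow>m. x\<^sup>2) = int n}"

text \<open>At \<open>n = 0\<close> only the values for \<open>s \<in> {3, 5, 7}\<close> carry meaning;
  the value 0 for other \<open>s\<close> is a dummy.\<close>

definition sigma_star :: "nat \<Rightarrow> nat \<Rightarrow> real" where
  "sigma_star s n =
     (if n = 0
      then (if s = 3 then - 1/16 else if s = 5 then 1/8 else if s = 7 then - 17/32 else 0)
      else - (\<Sum>d | d dvd n. (-1) ^ d * real d ^ s))"

text \<open>The infinite product is the limit in the \<open>X\<close>-adic topology on formal power series;
  it starts at \<open>k = 0\<close>, hence the shift to \<open>Suc k\<close>.\<close>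

definition ramanujan_tau :: "nat \<Rightarrow> int" where
  "ramanujan_tau n = fps_nth (fps_X * (\<Prod>k. (1 - fps_X ^ Suc k) ^ 24)) n"

lemma finite_sum_squares: "finite {m :: int list. length m = k \<and> (\<Sum>x\<leftarrow>m. x\<^sup>2) = int n}"
proof (rule finite_subset)
  show "{m :: int list. length m = k \<and> (\<Sum>x\<leftarrow>m. x\<^sup>2) = int n}
          \<subseteq> {m. set m \<subseteq> {- int n..int n} \<and> length m = k}"
  proof (intro subsetI CollectI conjI)
    fix m :: "int list" and x
    assume "m \<in> {m. length m = k \<and> (\<Sum>x\<leftarrow>m. x\<^sup>2) = int n}" and x: "x \<in> set m"
    hence m: "(\<Sum>x\<leftarrow>m. x\<^sup>2) = int n" by simp
    have "x\<^sup>2 \<le> (\<Sum>x\<leftarrow>m. x\<^sup>2)"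
      using x by (intro member_le_sum_list) auto
    moreover have "\<bar>x\<bar> \<le> x\<^sup>2"
      using self_le_power[of "\<bar>x\<bar>" 2] by (cases "x = 0") auto
    ultimately show "x \<in> {- int n..int n}"
      using m by auto
  qed simp
qed (simp add: finite_lists_length_eq)

lemma convergent_prod_tau: "convergent_prod (\<lambda>k. (1 - fps_X ^ Suc k :: int fps) ^ 24)"
proof -
  define f where "f = (\<lambda>k. (1 - fps_X ^ Suc k :: int fps) ^ 24)"
  define P where "P = Abs_fps (\<lambda>i. fps_nth (\<Prod>k\<le>i. f k) i)"
  have "x dvd (1 - x) ^ m - 1" for x :: "int fps" and m
  proof (induction m)
    case (Suc m)
    have "(1 - x) ^ Suc m - 1 = (1 - x) * ((1 - x) ^ m - 1) - x"
      by (simp add: algebra_simps)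
    thus ?case using Suc by (metis dvd_diff dvd_mult dvd_refl)
  qed simp
  hence dvd: "(fps_X :: int fps) ^ Suc k dvd f k - 1" for k
    unfolding f_def by blast
  have stable: "fps_nth (\<Prod>k\<le>Suc N. f k) i = fps_nth (\<Prod>k\<le>N. f k) i" if "i \<le> N" for i N
  proof -
    obtain g where g: "f (Suc N) - 1 = fps_X ^ Suc (Suc N) * g"
      using dvd[of "Suc N"] by (rule dvdE)
    have "(\<Prod>k\<le>Suc N. f k) = (\<Prod>k\<le>N. f k) + (\<Prod>k\<le>N. f k) * (f (Suc N) - 1)"
      by (simp add: algebra_simps)
    also have "\<dots> = (\<Prod>k\<le>N. f k) + fps_X ^ Suc (Suc N) * ((\<Prod>k\<le>N. f k) * g)"
      unfolding g by (simp only: mult.left_commute)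
    finally show ?thesis
      using that by (simp only: fps_add_nth fps_X_power_mult_nth) simp
  qed
  have const: "fps_nth (\<Prod>k\<le>N. f k) i = fps_nth P i" if "i \<le> N" for i N
    using that
  proof (induction N rule: dec_induct)
    case base
    show ?case unfolding P_def by simp
  next
    case (step N)
    thus ?case using stable[of i N] by simp
  qed
  have "(\<lambda>N. \<Prod>k\<le>N. f k) \<longlonglongrightarrow> P"
  proof (rule tendsto_fpsI)
    show "eventually (\<lambda>N. fps_nth (\<Prod>k\<le>N. f k) i = fps_nth P i) sequentially" for i
      using eventually_ge_at_top[of i] by eventually_elim (rule const)
  qed
  moreover have "fps_nth P 0 = 1"
    unfolding P_def f_def by (simp add: fps_nth_power_0)
  hence "P \<noteq> 0" by auto
  ultimately show ?thesis
    unfolding convergent_prod_def raw_has_prod_def f_def [symmetric]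
    by (intro exI[of _ 0] exI[of _ P]) simp
qed

lemma ramanujan_tau_0: "ramanujan_tau 0 = 0"
  by (simp add: ramanujan_tau_def)

end

theory Submission
  imports Defs
begin

text \<open>
  Replacing \<open>q\<close> by \<open>-q\<close> turns the claim into identities between the 24th power of
  \<open>\<theta> = (\<Sum>x\<in>\<int>. (-1) ^ x * q ^ x\<^sup>2)\<close>, the discriminant \<open>\<Delta>\<close>, and the Lambert series \<open>G\<^sub>s\<close> of
  \<open>\<sigma>\<^sup>*\<^sub>s\<close>. All of these are polynomials in two forms \<open>W\<close> and \<open>Q\<close> of weights 2 and 4 for
  \<open>\<Gamma>\<^sub>0(2)\<close>:
  \<open>\<theta>\<^sup>8 = Q\<close>, \<open>-16 G\<^sub>3 = Q\<close>, \<open>8 G\<^sub>5 = Q W\<close>, \<open>-32 G\<^sub>7 = Q (9 Q + 8 W\<^sup>2)\<close>, \<open>64 \<Delta> = Q\<^sup>2 (W\<^sup>2 - Q)\<close>.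

  All series are formal. Liouville's identity for \<open>F(a - b) - F(a + b)\<close>
  with \<open>F(l) = l\<^sup>2\<close>, \<open>l\<^sup>4\<close> and \<open>F(l) = (-1)\<^sup>l l\<^sup>2\<close>, \<open>(-1)\<^sup>l l\<^sup>4\<close>, \<open>(-1)\<^sup>l l\<^sup>6\<close> expresses
  derivatives \<open>q d/dq\<close> of Lambert series by products. Since the alternating series are linear
  combinations of the ordinary ones at \<open>q\<close> and \<open>q\<^sup>2\<close>, each weight gives an overdetermined system,
  which yields the formulas for the \<open>G\<^sub>s\<close> and the derivatives of \<open>W\<close> and \<open>Q\<close>. The formulas for
  \<open>\<theta>\<^sup>8\<close> and \<open>\<Delta>\<close> follow because both sides satisfy the same first-order linear differential
  equation; the logarithmic derivative of \<open>\<theta>\<close> is read off from Gauss's product.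
\<close>

section \<open>Lambert series and Liouville's identity\<close>

definition lambert_term :: "nat \<Rightarrow> real fps" where
  "lambert_term a = Abs_fps (\<lambda>n. if n > 0 \<and> a dvd n then 1 else 0)"

definition lambert :: "(nat \<Rightarrow> real) \<Rightarrow> real fps" where
  "lambert f = Abs_fps (\<lambda>n. if n = 0 then 0 else \<Sum>d | d dvd n. f d)"

text \<open>The formal double sum of \<open>H a b * lambert_term a * lambert_term b\<close> over all
  a, b >= 1. The cutoff at \<open>n\<close> loses nothing, since the product of two terms starts in
  degree a + b.\<close>

definition lambert2 :: "(nat \<Rightarrow> nat \<Rightarrow> real) \<Rightarrow> real fps" where
  "lambert2 H = Abs_fps (\<lambda>n. \<Sum>a=1..n. \<Sum>b=1..n. H a b * fps_nth (lambert_term a * lambert_term b) n)"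

lemma lambert_term_nth_eq_0: "n < a \<Longrightarrow> fps_nth (lambert_term a) n = 0"
  by (auto simp: lambert_term_def dest: dvd_imp_le)

lemma lambert_term_eq:
  assumes "a > 0"
  shows "(1 - fps_X ^ a) * lambert_term a = fps_X ^ a"
proof (rule fps_ext)
  fix n
  have "a dvd n - a \<longleftrightarrow> a dvd n" if "a \<le> n"
    using that by (metis dvd_add_triv_right_iff le_add_diff_inverse2)
  thus "fps_nth ((1 - fps_X ^ a) * lambert_term a) n = fps_nth (fps_X ^ a) n"
    using assms
    by (auto simp: left_diff_distrib fps_X_power_mult_nth lambert_term_def fps_X_power_nth
             dest: dvd_imp_le)
qed

lemma one_minus_X_power_neq_0: "a > 0 \<Longrightarrow> (1 - fps_X ^ a :: real fps) \<noteq> 0"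
  by (metis fps_nonzeroI fps_X_power_nth fps_one_nth fps_sub_nth diff_0_right
        less_irrefl zero_neq_one)

text \<open>With \<open>u a = X ^ a / (1 - X ^ a)\<close> this relation makes the sum of
  \<open>u (b + l) * u b\<close> over \<open>b\<close> telescope.\<close>

lemma lambert_term_mult:
  assumes "a > 0" "b > 0"
  shows "lambert_term a * lambert_term b =
           lambert_term (a + b) * (1 + lambert_term a + lambert_term b)"
proof -
  define x y u v w where defs: "x = (fps_X ^ a :: real fps)" "y = (fps_X ^ b :: real fps)"
    "u = lambert_term a" "v = lambert_term b" "w = lambert_term (a + b)"
  have eqs: "(1 - x) * u = x" "(1 - y) * v = y" "(1 - x * y) * w = x * y"
    unfolding defs power_add[symmetric] using assms by (simp_all add: lambert_term_eq)
  have ne: "(1 - x) * (1 - y) * (1 - x * y) \<noteq> 0"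
    unfolding defs power_add[symmetric] mult_eq_0_iff de_Morgan_disj
    using assms by (intro conjI one_minus_X_power_neq_0) auto
  have "(1 - x) * (1 - y) * (1 - x * y) * (u * v) =
        (1 - x * y) * (((1 - x) * u) * ((1 - y) * v))"
    by (simp add: mult_ac)
  \<comment> \<open>By \<open>eqs\<close> the bracket is (1 - x) (1 - y) + (1 - y) x + (1 - x) y = 1
    - x y.\<close>
  also have "\<dots> = ((1 - x * y) * w) * ((1 - x) * (1 - y) + (1 - y) * ((1 - x) * u) + (1 - x) * ((1 - y) * v))"
    unfolding eqs by (simp add: algebra_simps)
  also have "\<dots> = (1 - x) * (1 - y) * (1 - x * y) * (w * (1 + u + v))"
    by (simp add: algebra_simps)
  finally show ?thesis
    using ne unfolding defs by (simp only: mult_cancel_left) simp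
qed

section \<open>The derivation q d/dq and truncation of Lambert series\<close>

lemma fps_XD_mult: "fps_XD (f * g) = fps_XD f * g + f * fps_XD (g :: 'a :: comm_ring_1 fps)"
  by (simp add: fps_XD_def algebra_simps)

lemma fps_XD_X_power: "fps_XD (fps_X ^ a :: 'a :: comm_ring_1 fps) = of_nat a * fps_X ^ a"
  by (rule fps_ext) (simp add: fps_X_power_nth fps_of_nat[symmetric])

lemma fps_XD_diff: "fps_XD (f - g) = fps_XD f - fps_XD (g :: 'a :: comm_ring_1 fps)"
  by (rule fps_ext) (simp add: algebra_simps)

lemma fps_XD_1: "fps_XD (1 :: 'a :: comm_ring_1 fps) = 0"
  by (rule fps_ext) (simp)

lemma fps_XD_lambert_term:
  assumes "a > 0"
  shows "fps_XD (lambert_term a) = of_nat a * (lambert_term a + lambert_term a ^ 2)"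
proof -
  define x u where defs: "x = (fps_X ^ a :: real fps)" "u = lambert_term a"
  have eq: "(1 - x) * u = x" and ne: "1 - x \<noteq> 0"
    unfolding defs using assms by (rule lambert_term_eq, rule one_minus_X_power_neq_0)
  have "fps_XD ((1 - x) * u) = fps_XD x"
    using eq by simp
  hence "(1 - x) * fps_XD u = of_nat a * x * (1 + u)"
    unfolding fps_XD_mult fps_XD_diff fps_XD_1 defs(1) fps_XD_X_power by (simp add: algebra_simps)
  also have "\<dots> = of_nat a * ((1 - x) * u) * (1 + u)"
    by (simp add: eq)
  also have "\<dots> = (1 - x) * (of_nat a * (u + u ^ 2))"
    by (simp add: algebra_simps power2_eq_square)
  finally show ?thesis
    using ne unfolding defs by simp
qed

text \<open>The derivative formula solved for the square; q d/dq multiplies coefficient n by n.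
  These squares produce the derivative in \<open>liouville_identity\<close>.\<close>

lemma lambert_term_square_nth:
  assumes "a > 0"
  shows "fps_nth (lambert_term a * lambert_term a) n =
           (real n / real a - 1) * fps_nth (lambert_term a) n"
proof -
  have "fps_nth (fps_XD (lambert_term a)) n =
        fps_nth (fps_const (real a) * (lambert_term a + lambert_term a * lambert_term a)) n"
    by (simp only: fps_XD_lambert_term[OF assms] fps_of_nat power2_eq_square)
  hence "real n * fps_nth (lambert_term a) n =
           real a * (fps_nth (lambert_term a) n + fps_nth (lambert_term a * lambert_term a) n)"
    by (simp only: fps_XD_nth fps_mult_left_const_nth fps_add_nth)
  thus ?thesis
    using assms by (simp add: field_simps)
qed

text \<open>Terms with d > n do not reach degree n, so one cutoff \<open>N\<close> serves all
  coefficients up to \<open>N\<close>.\<close>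

lemma lambert_nth:
  assumes "n \<le> N"
  shows "fps_nth (lambert f) n = (\<Sum>d=1..N. f d * fps_nth (lambert_term d) n)"
proof (cases "n = 0")
  case False
  have "(\<Sum>d=1..N. f d * fps_nth (lambert_term d) n) =
        (\<Sum>d=1..N. if d dvd n then f d else 0)"
    using False by (intro sum.cong) (auto simp: lambert_term_def)
  also have "\<dots> = sum f ({1..N} \<inter> {d. d dvd n})"
    by (simp add: sum.inter_restrict)
  also have "{1..N} \<inter> {d. d dvd n} = {d. d dvd n}"
    using assms False by (auto intro!: Suc_leI intro: dvd_pos_nat order.trans[OF dvd_imp_le])
  finally show ?thesis
    using False by (simp add: lambert_def)
qed (simp add: lambert_def lambert_term_def)

text \<open>Allows infinite sums and products to be replaced by truncations inside a
  product.\<close>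

lemma fps_mult_nth_cong:
  assumes "\<And>i. i \<le> n \<Longrightarrow> fps_nth f i = fps_nth f' i"
    and "\<And>i. i \<le> n \<Longrightarrow> fps_nth g i = fps_nth g' i"
  shows "fps_nth (f * g) n = fps_nth (f' * g') n"
  using assms by (simp add: fps_mult_nth)

lemma lambert_mult: "lambert f * lambert g = lambert2 (\<lambda>a b. f a * g b)"
proof (rule fps_ext)
  fix n
  have "fps_nth (lambert f * lambert g) n =
        fps_nth ((\<Sum>a=1..n. fps_const (f a) * lambert_term a) *
                 (\<Sum>b=1..n. fps_const (g b) * lambert_term b)) n"
    by (rule fps_mult_nth_cong) (simp_all add: lambert_nth[of _ n] fps_sum_nth)
  also have "\<dots> = fps_nth (\<Sum>a=1..n. \<Sum>b=1..n. fps_const (f a * g b) *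
                     (lambert_term a * lambert_term b)) n"
    unfolding sum_product fps_const_mult[symmetric] by (simp only: mult_ac)
  also have "\<dots> = fps_nth (lambert2 (\<lambda>a b. f a * g b)) n"
    by (simp add: fps_sum_nth lambert2_def)
  finally show "fps_nth (lambert f * lambert g) n = fps_nth (lambert2 (\<lambda>a b. f a * g b)) n" .
qed

lemma lambert2_add: "lambert2 (\<lambda>a b. G a b + H a b) = lambert2 G + lambert2 H"
  by (rule fps_ext) (simp add: lambert2_def algebra_simps sum.distrib)

lemma lambert2_cmult: "lambert2 (\<lambda>a b. c * H a b) = fps_const c * lambert2 H"
  by (rule fps_ext) (simp add: lambert2_def algebra_simps sum_distrib_left)

lemma lambert_add: "lambert (\<lambda>d. f d + g d) = lambert f + lambert g"
  by (rule fps_ext) (simp add: lambert_def sum.distrib)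

lemma lambert_cmult: "lambert (\<lambda>d. c * f d) = fps_const c * lambert f"
  by (rule fps_ext) (simp add: lambert_def sum_distrib_left)

lemma lambert_cong: "(\<And>d. d > 0 \<Longrightarrow> f d = g d) \<Longrightarrow> lambert f = lambert g"
  by (rule fps_ext) (auto simp: lambert_def intro!: sum.cong dest: dvd_pos_nat)

lemma lambert_term_mult_nth_eq_0:
  assumes "n < a + b"
  shows "fps_nth (lambert_term a * lambert_term b) n = 0"
  unfolding fps_mult_nth
proof (rule sum.neutral, intro ballI)
  fix i assume "i \<in> {0..n}"
  hence "i < a \<or> n - i < b" using assms by auto
  thus "fps_nth (lambert_term a) i * fps_nth (lambert_term b) (n - i) = 0"
    by (auto simp: lambert_term_nth_eq_0)
qed

text \<open>\<open>lambert_term_mult\<close> pulls out the common factor with index a + (l - a) = l;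
  the reflection a -> l - a merges the two remaining sums.\<close>

lemma sum_diagonal_lambert_term_mult:
  assumes "l > 0"
  shows "(\<Sum>a=1..<l. lambert_term a * lambert_term (l - a)) =
           lambert_term l * (of_nat (l - 1) + 2 * (\<Sum>a=1..<l. lambert_term a))"
proof -
  have "(\<Sum>a=1..<l. lambert_term a * lambert_term (l - a)) =
        (\<Sum>a=1..<l. lambert_term l * (1 + lambert_term a + lambert_term (l - a)))"
    by (intro sum.cong) (auto simp: lambert_term_mult)
  also have "\<dots> = lambert_term l * (of_nat (l - 1) + (\<Sum>a=1..<l. lambert_term a) +
                       (\<Sum>a=1..<l. lambert_term (l - a)))"
    by (simp add: sum.distrib flip: sum_distrib_left)
  also have "(\<Sum>a=1..<l. lambert_term (l - a)) = (\<Sum>a=1..<l. lambert_term a)"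
    by (rule sum.reindex_bij_witness[of _ "\<lambda>a. l - a" "\<lambda>a. l - a"]) auto
  finally show ?thesis by (simp add: algebra_simps)
qed

text \<open>Solving \<open>lambert_term_mult\<close> for the product with indices b + l and b gives
  a difference in b with step l, so the sum telescopes and only the products with b <= l
  survive.\<close>

lemma sum_shifted_lambert_term_mult_nth:
  assumes "l > 0"
  shows "(\<Sum>b=1..n. fps_nth (lambert_term (b + l) * lambert_term b) n) =
           fps_nth (lambert_term l * (\<Sum>b=1..l. lambert_term b)) n -
           (\<Sum>b=l+1..n. fps_nth (lambert_term b) n)"
proof -
  let ?c = "\<lambda>b. fps_nth (lambert_term l * lambert_term b) n"
  have eq: "lambert_term (b + l) * lambert_term b =
        lambert_term l * lambert_term b - lambert_term l * lambert_term (b + l) - lambert_term (b + l)"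
    if "b \<in> {1..n}" for b
    using lambert_term_mult[of b l] that assms by (simp add: algebra_simps)
  have "(\<Sum>b=1..n. fps_nth (lambert_term (b + l) * lambert_term b) n) =
        (\<Sum>b=1..n. ?c b) - (\<Sum>b=1..n. ?c (b + l)) - (\<Sum>b=1..n. fps_nth (lambert_term (b + l)) n)"
    by (simp add: eq sum_subtractf)
  also have "(\<Sum>b=1..n. ?c (b + l)) = (\<Sum>b=l+1..n+l. ?c b)"
    by (rule sum.reindex_bij_witness[of _ "\<lambda>b. b - l" "\<lambda>b. b + l"]) auto
  also have "(\<Sum>b=1..n. fps_nth (lambert_term (b + l)) n) = (\<Sum>b=l+1..n+l. fps_nth (lambert_term b) n)"
    by (rule sum.reindex_bij_witness[of _ "\<lambda>b. b - l" "\<lambda>b. b + l"]) auto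
  also have "\<dots> = (\<Sum>b=l+1..n. fps_nth (lambert_term b) n)"
    by (rule sum.mono_neutral_right) (auto simp: lambert_term_nth_eq_0)
  \<comment> \<open>For b > n the products vanish in degree n. With the range raised to n + l, all
    terms b > l cancel against the shifted sum.\<close>
  also have "(\<Sum>b=1..n. ?c b) = (\<Sum>b=1..n+l. ?c b)"
    by (rule sum.mono_neutral_left) (auto simp: lambert_term_mult_nth_eq_0)
  also have "(\<Sum>b=1..n+l. ?c b) = (\<Sum>b=1..l. ?c b) + (\<Sum>b=l+1..n+l. ?c b)"
    using sum.ub_add_nat[of 1 l ?c n] assms by (simp add: add.commute)
  finally show ?thesis
    by (simp add: sum_distrib_left fps_sum_nth)
qed

section \<open>Sorting double sums by the sum or the difference of the indices\<close>

lemma sum_add_reindex: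
  fixes g :: "nat \<Rightarrow> nat \<Rightarrow> real"
  assumes "\<And>a b. a + b > n \<Longrightarrow> g a b = 0"
  shows "(\<Sum>a=1..n. \<Sum>b=1..n. g a b) = (\<Sum>l=1..n. \<Sum>a=1..<l. g a (l - a))"
proof -
  have "(\<Sum>a=1..n. \<Sum>b=1..n. g a b) = (\<Sum>(a, b)\<in>{1..n} \<times> {1..n}. g a b)"
    by (simp add: sum.cartesian_product)
  also have "\<dots> = (\<Sum>(a, b)\<in>{(a, b). 1 \<le> a \<and> 1 \<le> b \<and> a + b \<le> n}. g a b)"
    by (rule sum.mono_neutral_right) (auto intro: ccontr simp: assms not_le[symmetric])
  also have "\<dots> = (\<Sum>(l, a)\<in>(SIGMA l:{1..n}. {1..<l}). g a (l - a))"
    by (rule sum.reindex_bij_witness[of _ "\<lambda>(l, a). (a, l - a)" "\<lambda>(a, b). (a + b, a)"]) auto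
  also have "\<dots> = (\<Sum>l=1..n. \<Sum>a=1..<l. g a (l - a))"
    by (simp add: sum.Sigma)
  finally show ?thesis .
qed

text \<open>Symmetry lets the pairs a > b count twice; after a = b + l, pairs with b + l > n
  contribute nothing.\<close>

lemma sum_diff_reindex:
  fixes g :: "nat \<Rightarrow> nat \<Rightarrow> real"
  assumes "\<And>a b. a + b > n \<Longrightarrow> g a b = 0" "\<And>a b. g a b = g b a" "\<And>a. g a a = 0"
  shows "(\<Sum>a=1..n. \<Sum>b=1..n. g a b) = 2 * (\<Sum>l=1..n. \<Sum>b=1..n. g (b + l) b)"
proof -
  let ?A = "{(a, b). a \<in> {1..n} \<and> b \<in> {1..n} \<and> b < a}"
  let ?B = "{(a, b). a \<in> {1..n} \<and> b \<in> {1..n} \<and> a < b}"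
  have fin: "finite ?A" "finite ?B"
    by (rule finite_subset[of _ "{1..n} \<times> {1..n}"]; auto)+
  have "(\<Sum>a=1..n. \<Sum>b=1..n. g a b) = (\<Sum>(a, b)\<in>{1..n} \<times> {1..n}. g a b)"
    by (simp add: sum.cartesian_product)
  also have "\<dots> = (\<Sum>(a, b)\<in>?A \<union> ?B. g a b)"
    by (rule sum.mono_neutral_right) (auto simp: assms(3) not_less_iff_gr_or_eq)
  also have "\<dots> = (\<Sum>(a, b)\<in>?A. g a b) + (\<Sum>(a, b)\<in>?B. g a b)"
    using fin by (intro sum.union_disjoint) auto
  also have "(\<Sum>(a, b)\<in>?B. g a b) = (\<Sum>(a, b)\<in>?A. g a b)"
    by (rule sum.reindex_bij_witness[of _ "\<lambda>(a, b). (b, a)" "\<lambda>(a, b). (b, a)"]) (auto simp: assms(2))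
  also have "(\<Sum>(a, b)\<in>?A. g a b) =
             (\<Sum>(l, b)\<in>{(l, b). l \<in> {1..n} \<and> b \<in> {1..n} \<and> b + l \<le> n}. g (b + l) b)"
    by (rule sum.reindex_bij_witness[of _ "\<lambda>(l, b). (b + l, b)" "\<lambda>(a, b). (a - b, b)"]) auto
  also have "\<dots> = (\<Sum>(l, b)\<in>{1..n} \<times> {1..n}. g (b + l) b)"
    by (rule sum.mono_neutral_left) (auto intro: ccontr simp: assms(1) not_le[symmetric])
  finally show ?thesis
    by (simp add: sum.cartesian_product)
qed

text \<open>Liouville's identity; it encodes Ramanujan's formula for the square of
  \<open>cot (t/2) / 4 + (\<Sum>k. X ^ k / (1 - X ^ k) * sin (k * t))\<close>.\<close>

lemma liouville_identity:
  fixes F :: "int \<Rightarrow> real"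
  assumes even: "\<And>x. F (- x) = F x" and F0: "F 0 = 0"
  shows "lambert2 (\<lambda>a b. F (int a - int b) - F (int a + int b)) =
           fps_XD (lambert (\<lambda>l. 2 * F (int l) / real l)) -
           lambert (\<lambda>b. (real b + 1) * F (int b) + 2 * (\<Sum>l=1..<b. F (int l)))"
proof (rule fps_ext)
  fix n
  let ?u = lambert_term
  define c where "c = (\<lambda>a b. fps_nth (?u a * ?u b) n)"
  define v where "v = (\<lambda>a. fps_nth (?u a) n)"
  have c0: "c a b = 0" if "n < a + b" for a b
    using that by (simp add: c_def lambert_term_mult_nth_eq_0)
  have "fps_nth (lambert2 (\<lambda>a b. F (int a - int b) - F (int a + int b))) n =
        (\<Sum>a=1..n. \<Sum>b=1..n. F (int a - int b) * c a b) - (\<Sum>a=1..n. \<Sum>b=1..n. F (int a + int b) * c a b)"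
    by (simp add: lambert2_def c_def left_diff_distrib sum_subtractf)
  \<comment> \<open>Terms F (a + b) are collected by l = a + b and terms F (a - b) by l = a - b > 0,
    which leaves the two inner sums evaluated above.\<close>
  also have "(\<Sum>a=1..n. \<Sum>b=1..n. F (int a + int b) * c a b) =
             (\<Sum>l=1..n. \<Sum>a=1..<l. F (int a + int (l - a)) * c a (l - a))"
    by (rule sum_add_reindex) (simp add: c0)
  also have "\<dots> = (\<Sum>l=1..n. F (int l) * (\<Sum>a=1..<l. c a (l - a)))"
    unfolding sum_distrib_left by (intro sum.cong refl) (auto simp: of_nat_diff)
  also have "(\<Sum>a=1..n. \<Sum>b=1..n. F (int a - int b) * c a b) =
             2 * (\<Sum>l=1..n. \<Sum>b=1..n. F (int (b + l) - int b) * c (b + l) b)"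
  proof (rule sum_diff_reindex)
    show "F (int a - int b) * c a b = F (int b - int a) * c b a" for a b
      using even[of "int a - int b"] by (simp add: c_def mult.commute)
  qed (simp_all add: c0 F0)
  also have "\<dots> = 2 * (\<Sum>l=1..n. F (int l) * (\<Sum>b=1..n. c (b + l) b))"
    by (simp add: sum_distrib_left)
  also have "\<dots> - (\<Sum>l=1..n. F (int l) * (\<Sum>a=1..<l. c a (l - a))) =
             (\<Sum>l=1..n. F (int l) * (2 * (\<Sum>b=1..n. c (b + l) b) - (\<Sum>a=1..<l. c a (l - a))))"
    by (simp add: sum_distrib_left sum_subtractf algebra_simps)
  also have "\<dots> = (\<Sum>l=1..n. F (int l) * ((2 * real n / real l - real l - 1) * v l - 2 * (\<Sum>b=l+1..n. v b)))"
  proof (intro sum.cong refl arg_cong2[where f = "(*)"])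
    fix l assume "l \<in> {1..n}"
    hence l: "l > 0" by simp
    have "(\<Sum>a=1..<l. c a (l - a)) = fps_nth (\<Sum>a=1..<l. ?u a * ?u (l - a)) n"
      by (simp add: c_def fps_sum_nth)
    also have "\<dots> = fps_nth (fps_const (real (l - 1)) * ?u l + fps_const 2 * (?u l * (\<Sum>a=1..<l. ?u a))) n"
      unfolding sum_diagonal_lambert_term_mult[OF l] fps_of_nat
      by (simp add: algebra_simps flip: numeral_fps_const)
    also have "\<dots> = (real l - 1) * v l + 2 * fps_nth (?u l * (\<Sum>a=1..<l. ?u a)) n"
      using l by (simp add: v_def of_nat_diff)
    finally have 1: "(\<Sum>a=1..<l. c a (l - a)) = \<dots>" .
    \<comment> \<open>The shifted sum includes b = l while the diagonal one stops before l. The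
      extra square yields the quotient n / l, hence the derivative; all other products
      cancel.\<close>
    have "{1..l} = insert l {1..<l}" using l by auto
    hence "?u l * (\<Sum>b=1..l. ?u b) = ?u l * ?u l + ?u l * (\<Sum>b=1..<l. ?u b)"
      by (simp add: algebra_simps)
    hence 2: "(\<Sum>b=1..n. c (b + l) b) = (real n / real l - 1) * v l +
                 fps_nth (?u l * (\<Sum>a=1..<l. ?u a)) n - (\<Sum>b=l+1..n. v b)"
      unfolding c_def v_def sum_shifted_lambert_term_mult_nth[OF l]
      by (simp add: lambert_term_square_nth[OF l])
    show "2 * (\<Sum>b=1..n. c (b + l) b) - (\<Sum>a=1..<l. c a (l - a)) =
            (2 * real n / real l - real l - 1) * v l - 2 * (\<Sum>b=l+1..n. v b)"
      unfolding 1 2 by (simp add: algebra_simps)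
  qed
  also have "\<dots> = (\<Sum>l=1..n. F (int l) * (2 * real n / real l - real l - 1) * v l) -
                  2 * (\<Sum>l=1..n. \<Sum>b=l+1..n. F (int l) * v b)"
    by (simp add: sum_distrib_left sum_subtractf sum.distrib algebra_simps)
  \<comment> \<open>Interchanging the summations turns tails over b > l into partial sums of F below
    b.\<close>
  also have "(\<Sum>l=1..n. \<Sum>b=l+1..n. F (int l) * v b) = (\<Sum>b=1..n. \<Sum>l=1..<b. F (int l) * v b)"
    unfolding sum.Sigma[OF finite_atLeastAtMost ballI[OF finite_atLeastAtMost]]
              sum.Sigma[OF finite_atLeastAtMost ballI[OF finite_atLeastLessThan]]
    by (rule sum.reindex_bij_witness[of _ "\<lambda>(b, l). (l, b)" "\<lambda>(l, b). (b, l)"]) auto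
  also have "(\<Sum>l=1..n. F (int l) * (2 * real n / real l - real l - 1) * v l) -
               2 * (\<Sum>b=1..n. \<Sum>l=1..<b. F (int l) * v b) =
             real n * (\<Sum>l=1..n. 2 * F (int l) / real l * v l) -
             (\<Sum>b=1..n. ((real b + 1) * F (int b) + 2 * (\<Sum>l=1..<b. F (int l))) * v b)"
    by (simp add: sum_distrib_left sum_distrib_right sum_subtractf sum.distrib algebra_simps)
  also have "\<dots> = fps_nth (fps_XD (lambert (\<lambda>l. 2 * F (int l) / real l)) -
           lambert (\<lambda>b. (real b + 1) * F (int b) + 2 * (\<Sum>l=1..<b. F (int l)))) n"
    by (simp add: lambert_nth[of n n] v_def)
  finally show "fps_nth (lambert2 (\<lambda>a b. F (int a - int b) - F (int a + int b))) n = \<dots>" .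
qed

section \<open>Quadratic relations between Lambert series\<close>

definition power_lambert :: "nat \<Rightarrow> real fps" where
  "power_lambert s = lambert (\<lambda>d. real d ^ s)"

definition alt_lambert :: "nat \<Rightarrow> real fps" where
  "alt_lambert s = lambert (\<lambda>d. (-1) ^ d * real d ^ s)"

abbreviation fps_double :: "real fps \<Rightarrow> real fps" where
  "fps_double f \<equiv> f oo fps_X ^ 2"

lemma fps_double_nth: "fps_nth (fps_double f) n = (if even n then fps_nth f (n div 2) else 0)"
proof -
  have "fps_nth (fps_double f) n = (\<Sum>i=0..n. if n = 2 * i then fps_nth f i else 0)"
    unfolding fps_compose_nth by (intro sum.cong) (auto simp: fps_X_power_nth simp flip: power_mult)
  also have "\<dots> = (if even n then fps_nth f (n div 2) else 0)"
  proof (cases "even n")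
    case True
    then obtain k where k: "n = 2 * k" by (rule evenE)
    have "(\<Sum>i=0..n. if n = 2 * i then fps_nth f i else 0) = (\<Sum>i=0..n. if i = k then fps_nth f i else 0)"
      using k by (intro sum.cong) auto
    thus ?thesis using k by simp
  qed (auto intro!: sum.neutral)
  finally show ?thesis .
qed

lemma fps_XD_double: "fps_XD (fps_double f) = 2 * fps_double (fps_XD f)"
  by (rule fps_ext) (auto simp: fps_double_nth numeral_fps_const elim!: evenE)

text \<open>The sign (-1)^d is 2 [d even] - 1, and the even divisors of n are the doubled divisors
  of n / 2.\<close>

lemma alt_lambert_conv_power_lambert:
  "alt_lambert s = fps_const (2 ^ Suc s) * fps_double (power_lambert s) - power_lambert s"
proof (rule fps_ext)
  fix n
  show "fps_nth (alt_lambert s) n =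
          fps_nth (fps_const (2 ^ Suc s) * fps_double (power_lambert s) - power_lambert s) n"
  proof (cases "n = 0")
    case False
    have fin: "finite {d. d dvd n}" using False by simp
    have "(\<Sum>d | d dvd n. (-1) ^ d * real d ^ s) =
          (\<Sum>d | d dvd n. 2 * (if even d then real d ^ s else 0) - real d ^ s)"
      by (intro sum.cong) auto
    also have "\<dots> = 2 * (\<Sum>d | d dvd n. if even d then real d ^ s else 0) - (\<Sum>d | d dvd n. real d ^ s)"
      by (simp add: sum_subtractf sum_distrib_left)
    also have "(\<Sum>d | d dvd n. if even d then real d ^ s else 0) = (\<Sum>d\<in>{d. d dvd n} \<inter> {d. even d}. real d ^ s)"
      using fin by (simp add: sum.inter_restrict)
    also have "\<dots> = (if even n then \<Sum>d | d dvd n div 2. 2 ^ s * real d ^ s else 0)"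
    proof (cases "even n")
      case True
      then obtain k where k: "n = 2 * k" by (rule evenE)
      have "(\<Sum>d\<in>{d. d dvd n} \<inter> {d. even d}. real d ^ s) = (\<Sum>d | d dvd k. 2 ^ s * real d ^ s)"
        by (rule sum.reindex_bij_witness[of _ "\<lambda>d. 2 * d" "\<lambda>d. d div 2"])
           (auto simp: k power_mult_distrib elim!: evenE)
      thus ?thesis using k by simp
    next
      case False
      hence "{d. d dvd n} \<inter> {d. even d} = {}"
        using dvd_trans by blast
      thus ?thesis using False by simp
    qed
    finally show ?thesis
      using False
      by (auto simp: alt_lambert_def power_lambert_def lambert_def fps_double_nth sum_distrib_left elim!: evenE)
  qed (simp add: alt_lambert_def power_lambert_def lambert_def fps_double_nth)
qed

text \<open>For F(l) = 3 l^2, F(a - b) - F(a + b) = -12 a b; the 3 clears the denominators of the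
  sum of squares. This is Ramanujan's equation 12 q dE_2/dq = E_2^2 - E_4.\<close>

lemma power_lambert_ode_1:
  "12 * (power_lambert 1 * power_lambert 1) + 6 * fps_XD (power_lambert 1) =
     5 * power_lambert 3 + power_lambert 1"
proof -
  let ?F = "\<lambda>x::int. 3 * (real_of_int x)\<^sup>2"
  have 1: "lambert2 (\<lambda>a b. ?F (int a - int b) - ?F (int a + int b)) =
        fps_const (-12) * (power_lambert 1 * power_lambert 1)"
    unfolding power_lambert_def lambert_mult lambert2_cmult[symmetric]
    by (simp add: power2_eq_square algebra_simps)
  have 2: "lambert (\<lambda>l. 2 * ?F (int l) / real l) = fps_const 6 * power_lambert 1"
    unfolding power_lambert_def lambert_cmult[symmetric]
    by (rule lambert_cong) (simp add: power2_eq_square)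
  \<comment> \<open>The even power of b in Faulhaber's formula cancels against F b, so only odd
    powers remain.\<close>
  have "(real b + 1) * ?F (int b) + 2 * (\<Sum>l=1..<b. ?F (int l)) = 5 * real b ^ 3 + real b ^ 1"
    if "b > 0" for b
    using that by (induction b rule: nat_induct_non_zero) (simp_all add: algebra_simps power_numeral_reduce)
  hence 3: "lambert (\<lambda>b. (real b + 1) * ?F (int b) + 2 * (\<Sum>l=1..<b. ?F (int l))) =
        fps_const 5 * power_lambert 3 + power_lambert 1"
    unfolding power_lambert_def lambert_cmult[symmetric] lambert_add[symmetric]
    by (rule lambert_cong)
  have "fps_const (-12) * (power_lambert 1 * power_lambert 1) =
      fps_XD (fps_const 6 * power_lambert 1) - (fps_const 5 * power_lambert 3 + power_lambert 1)"
    unfolding 1[symmetric] 2[symmetric] 3[symmetric] by (rule liouville_identity) auto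
  thus ?thesis
    unfolding fps_XD_mult_const by (simp add: algebra_simps flip: numeral_fps_const fps_const_neg)
qed

text \<open>The case F(l) = 15 l^4, equivalent to Ramanujan's 3 q dE_4/dq = E_2 E_4 - E_6.\<close>

lemma power_lambert_ode_3:
  "240 * (power_lambert 1 * power_lambert 3) + 30 * fps_XD (power_lambert 3) =
     21 * power_lambert 5 + 10 * power_lambert 3 - power_lambert 1"
proof -
  let ?F = "\<lambda>x::int. 15 * real_of_int x ^ 4"
  have 1: "lambert2 (\<lambda>a b. ?F (int a - int b) - ?F (int a + int b)) =
        fps_const (-120) * (power_lambert 1 * power_lambert 3) +
        fps_const (-120) * (power_lambert 3 * power_lambert 1)"
    unfolding power_lambert_def lambert_mult lambert2_cmult[symmetric] lambert2_add[symmetric]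
    by (simp add: power_numeral_reduce algebra_simps)
  have 2: "lambert (\<lambda>l. 2 * ?F (int l) / real l) = fps_const 30 * power_lambert 3"
    unfolding power_lambert_def lambert_cmult[symmetric]
    by (rule lambert_cong) (simp add: power_numeral_reduce)
  have "(real b + 1) * ?F (int b) + 2 * (\<Sum>l=1..<b. ?F (int l)) =
          21 * real b ^ 5 + 10 * real b ^ 3 + (-1) * real b ^ 1"
    if "b > 0" for b
    using that by (induction b rule: nat_induct_non_zero) (simp_all add: algebra_simps power_numeral_reduce)
  hence 3: "lambert (\<lambda>b. (real b + 1) * ?F (int b) + 2 * (\<Sum>l=1..<b. ?F (int l))) =
        fps_const 21 * power_lambert 5 + fps_const 10 * power_lambert 3 + fps_const (-1) * power_lambert 1"
    unfolding power_lambert_def lambert_cmult[symmetric] lambert_add[symmetric]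
    by (rule lambert_cong)
  have "fps_const (-120) * (power_lambert 1 * power_lambert 3) +
        fps_const (-120) * (power_lambert 3 * power_lambert 1) =
      fps_XD (fps_const 30 * power_lambert 3) -
      (fps_const 21 * power_lambert 5 + fps_const 10 * power_lambert 3 + fps_const (-1) * power_lambert 1)"
    unfolding 1[symmetric] 2[symmetric] 3[symmetric] by (rule liouville_identity) auto
  thus ?thesis
    unfolding fps_XD_mult_const by (simp add: algebra_simps flip: numeral_fps_const fps_const_neg)
qed

section \<open>The relations twisted by a sign\<close>

definition int_sign :: "int \<Rightarrow> real" where
  "int_sign x = (if even x then 1 else -1)"

text \<open>As a - b and a + b have equal parity, the sign splits as (-1)^a (-1)^b, and the double
  series stays a combination of products of alternating Lambert series.\<close>

lemma int_sign_simps: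
  "int_sign (int a) = (-1) ^ a"
  "int_sign (int a - int b) = (-1) ^ a * (-1) ^ b"
  "int_sign (int a + int b) = (-1) ^ a * (-1) ^ b"
  "int_sign (- x) = int_sign x"
  by (auto simp: int_sign_def)

text \<open>Here F(l) = (-1)^l l^2. Twice the alternating sum of squares below b is (-1)^b (b -
  b^2), so there are no denominators to clear.\<close>

lemma alt_lambert_ode_1:
  "4 * (alt_lambert 1 * alt_lambert 1) + 2 * fps_XD (alt_lambert 1) = alt_lambert 3 + alt_lambert 1"
proof -
  let ?F = "\<lambda>x::int. int_sign x * (real_of_int x)\<^sup>2"
  have 1: "lambert2 (\<lambda>a b. ?F (int a - int b) - ?F (int a + int b)) =
        fps_const (-4) * (alt_lambert 1 * alt_lambert 1)"
    unfolding alt_lambert_def lambert_mult lambert2_cmult[symmetric]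
    by (simp add: power2_eq_square algebra_simps int_sign_simps)
  have 2: "lambert (\<lambda>l. 2 * ?F (int l) / real l) = fps_const 2 * alt_lambert 1"
    unfolding alt_lambert_def lambert_cmult[symmetric]
    by (rule lambert_cong) (simp add: power2_eq_square int_sign_simps)
  have "(real b + 1) * ?F (int b) + 2 * (\<Sum>l=1..<b. ?F (int l)) = (-1) ^ b * real b ^ 3 + (-1) ^ b * real b ^ 1"
    if "b > 0" for b
    using that by (induction b rule: nat_induct_non_zero)
      (simp_all add: algebra_simps power_numeral_reduce int_sign_simps del: of_nat_Suc, simp add: algebra_simps)
  hence 3: "lambert (\<lambda>b. (real b + 1) * ?F (int b) + 2 * (\<Sum>l=1..<b. ?F (int l))) =
        alt_lambert 3 + alt_lambert 1"
    unfolding alt_lambert_def lambert_cmult[symmetric] lambert_add[symmetric]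
    by (rule lambert_cong)
  have "fps_const (-4) * (alt_lambert 1 * alt_lambert 1) =
      fps_XD (fps_const 2 * alt_lambert 1) - (alt_lambert 3 + alt_lambert 1)"
    unfolding 1[symmetric] 2[symmetric] 3[symmetric] by (rule liouville_identity) (auto simp: int_sign_simps)
  thus ?thesis
    unfolding fps_XD_mult_const by (simp add: algebra_simps flip: numeral_fps_const fps_const_neg)
qed

lemma alt_lambert_ode_3:
  "16 * (alt_lambert 1 * alt_lambert 3) + 2 * fps_XD (alt_lambert 3) =
     alt_lambert 5 + 2 * alt_lambert 3 - alt_lambert 1"
proof -
  let ?F = "\<lambda>x::int. int_sign x * real_of_int x ^ 4"
  have 1: "lambert2 (\<lambda>a b. ?F (int a - int b) - ?F (int a + int b)) =
        fps_const (-8) * (alt_lambert 1 * alt_lambert 3) +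
        fps_const (-8) * (alt_lambert 3 * alt_lambert 1)"
    unfolding alt_lambert_def lambert_mult lambert2_cmult[symmetric] lambert2_add[symmetric]
    by (simp add: power_numeral_reduce algebra_simps int_sign_simps)
  have 2: "lambert (\<lambda>l. 2 * ?F (int l) / real l) = fps_const 2 * alt_lambert 3"
    unfolding alt_lambert_def lambert_cmult[symmetric]
    by (rule lambert_cong) (simp add: power_numeral_reduce int_sign_simps)
  have "(real b + 1) * ?F (int b) + 2 * (\<Sum>l=1..<b. ?F (int l)) =
          (-1) ^ b * real b ^ 5 + 2 * ((-1) ^ b * real b ^ 3) + (-1) * ((-1) ^ b * real b ^ 1)"
    if "b > 0" for b
    using that by (induction b rule: nat_induct_non_zero)
      (simp_all add: algebra_simps power_numeral_reduce int_sign_simps del: of_nat_Suc, simp add: algebra_simps)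
  hence 3: "lambert (\<lambda>b. (real b + 1) * ?F (int b) + 2 * (\<Sum>l=1..<b. ?F (int l))) =
        alt_lambert 5 + fps_const 2 * alt_lambert 3 + fps_const (-1) * alt_lambert 1"
    unfolding alt_lambert_def lambert_cmult[symmetric] lambert_add[symmetric]
    by (rule lambert_cong)
  have "fps_const (-8) * (alt_lambert 1 * alt_lambert 3) +
        fps_const (-8) * (alt_lambert 3 * alt_lambert 1) =
      fps_XD (fps_const 2 * alt_lambert 3) -
      (alt_lambert 5 + fps_const 2 * alt_lambert 3 + fps_const (-1) * alt_lambert 1)"
    unfolding 1[symmetric] 3[symmetric] unfolding 2[symmetric] by (rule liouville_identity) (auto simp: int_sign_simps)
  thus ?thesis
    unfolding fps_XD_mult_const by (simp add: algebra_simps flip: numeral_fps_const fps_const_neg)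
qed

text \<open>In (a - b)^6 - (a + b)^6 the middle term -40 a^3 b^3 is the source of the square of
  \<open>alt_lambert 3\<close>.\<close>

lemma alt_lambert_ode_5:
  "24 * (alt_lambert 1 * alt_lambert 5) + 40 * (alt_lambert 3 * alt_lambert 3) + 2 * fps_XD (alt_lambert 5) =
     alt_lambert 7 + 3 * alt_lambert 5 - 5 * alt_lambert 3 + 3 * alt_lambert 1"
proof -
  let ?F = "\<lambda>x::int. int_sign x * real_of_int x ^ 6"
  have 1: "lambert2 (\<lambda>a b. ?F (int a - int b) - ?F (int a + int b)) =
        fps_const (-12) * (alt_lambert 1 * alt_lambert 5) +
        fps_const (-40) * (alt_lambert 3 * alt_lambert 3) +
        fps_const (-12) * (alt_lambert 5 * alt_lambert 1)"
    unfolding alt_lambert_def lambert_mult lambert2_cmult[symmetric] lambert2_add[symmetric]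
    by (simp add: power_numeral_reduce algebra_simps int_sign_simps)
  have 2: "lambert (\<lambda>l. 2 * ?F (int l) / real l) = fps_const 2 * alt_lambert 5"
    unfolding alt_lambert_def lambert_cmult[symmetric]
    by (rule lambert_cong) (simp add: power_numeral_reduce int_sign_simps)
  have "(real b + 1) * ?F (int b) + 2 * (\<Sum>l=1..<b. ?F (int l)) =
          (-1) ^ b * real b ^ 7 + 3 * ((-1) ^ b * real b ^ 5) + (-5) * ((-1) ^ b * real b ^ 3) +
          3 * ((-1) ^ b * real b ^ 1)"
    if "b > 0" for b
    using that by (induction b rule: nat_induct_non_zero)
      (simp_all add: algebra_simps power_numeral_reduce int_sign_simps del: of_nat_Suc, simp add: algebra_simps)
  hence 3: "lambert (\<lambda>b. (real b + 1) * ?F (int b) + 2 * (\<Sum>l=1..<b. ?F (int l))) =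
        alt_lambert 7 + fps_const 3 * alt_lambert 5 + fps_const (-5) * alt_lambert 3 +
        fps_const 3 * alt_lambert 1"
    unfolding alt_lambert_def lambert_cmult[symmetric] lambert_add[symmetric]
    by (rule lambert_cong)
  have "fps_const (-12) * (alt_lambert 1 * alt_lambert 5) +
        fps_const (-40) * (alt_lambert 3 * alt_lambert 3) +
        fps_const (-12) * (alt_lambert 5 * alt_lambert 1) =
      fps_XD (fps_const 2 * alt_lambert 5) -
      (alt_lambert 7 + fps_const 3 * alt_lambert 5 + fps_const (-5) * alt_lambert 3 +
        fps_const 3 * alt_lambert 1)"
    unfolding 1[symmetric] 2[symmetric] 3[symmetric] by (rule liouville_identity) (auto simp: int_sign_simps)
  thus ?thesis
    unfolding fps_XD_mult_const by (simp add: algebra_simps flip: numeral_fps_const fps_const_neg)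
qed

text \<open>\<open>ramamani_P\<close>, \<open>ramamani_W\<close> and \<open>ramamani_Q\<close> are Ramamani's analogues for \<open>\<Gamma>\<^sub>0(2)\<close>
  of Ramanujan's \<open>P\<close>, \<open>Q\<close>, \<open>R\<close>, of weights 2, 2 and 4; the first is only quasimodular.\<close>

definition eis_P :: "real fps" where "eis_P = 1 - 24 * power_lambert 1"
definition ramamani_P :: "real fps" where "ramamani_P = 1 - 8 * alt_lambert 1"
definition ramamani_W :: "real fps" where "ramamani_W = 1 - 12 * alt_lambert 1 + 12 * power_lambert 1"
definition ramamani_Q :: "real fps" where "ramamani_Q = 1 + 16 * alt_lambert 3"

lemma fps_XD_numeral_mult: "fps_XD (numeral k * f) = numeral k * fps_XD (f :: real fps)"
  by (simp only: numeral_fps_const fps_XD_mult_const)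

section \<open>Elimination in weights 4, 6 and 8\<close>

lemma double_power_lambert_ode_1:
  "12 * (fps_double (power_lambert 1) * fps_double (power_lambert 1)) + 3 * fps_XD (fps_double (power_lambert 1)) =
     5 * fps_double (power_lambert 3) + fps_double (power_lambert 1)"
  using arg_cong[OF power_lambert_ode_1, of fps_double]
  by (simp add: fps_compose_add_distrib fps_compose_mult_distrib fps_XD_double)

lemma double_power_lambert_ode_3:
  "240 * (fps_double (power_lambert 1) * fps_double (power_lambert 3)) +
     15 * fps_XD (fps_double (power_lambert 3)) =
     21 * fps_double (power_lambert 5) + 10 * fps_double (power_lambert 3) - fps_double (power_lambert 1)"
  using arg_cong[OF power_lambert_ode_3, of fps_double]
  by (simp add: fps_compose_add_distrib fps_compose_sub_distrib fps_compose_mult_distrib fps_XD_double)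

lemma alt_lambert_conv:
  "alt_lambert 1 = 4 * fps_double (power_lambert 1) - power_lambert 1"
  "alt_lambert 3 = 16 * fps_double (power_lambert 3) - power_lambert 3"
  "alt_lambert 5 = 64 * fps_double (power_lambert 5) - power_lambert 5"
  using alt_lambert_conv_power_lambert[of 1] alt_lambert_conv_power_lambert[of 3]
        alt_lambert_conv_power_lambert[of 5]
  by (simp_all flip: numeral_fps_const)

lemma fps_XD_alt_lambert_conv:
  "fps_XD (alt_lambert 1) = 4 * fps_XD (fps_double (power_lambert 1)) - fps_XD (power_lambert 1)"
  "fps_XD (alt_lambert 3) = 16 * fps_XD (fps_double (power_lambert 3)) - fps_XD (power_lambert 3)"
  unfolding alt_lambert_conv fps_XD_diff fps_XD_numeral_mult by simp_all

text \<open>The relations at q, at q^2 and with signs are three equations for two independent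
  derivatives; eliminating these leaves an identity without derivatives. The bracket is E_4.\<close>

lemma ramamani_W_square: "4 * ramamani_W\<^sup>2 = 3 * ramamani_Q + (1 + 240 * power_lambert 3)"
  unfolding ramamani_W_def ramamani_Q_def
  using power_lambert_ode_1 double_power_lambert_ode_1 alt_lambert_ode_1 alt_lambert_conv(1,2)
    fps_XD_alt_lambert_conv(1)
  by algebra

lemma fps_XD_ramamani_W: "2 * fps_XD ramamani_W = ramamani_W * ramamani_P - ramamani_Q"
proof -
  have "fps_XD ramamani_W = 12 * fps_XD (power_lambert 1) - 12 * fps_XD (alt_lambert 1)"
    unfolding ramamani_W_def fps_XD_add fps_XD_diff fps_XD_numeral_mult fps_XD_1 by simp
  thus ?thesis
    using power_lambert_ode_1 alt_lambert_ode_1 ramamani_W_square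
    unfolding ramamani_W_def ramamani_Q_def ramamani_P_def by algebra
qed

lemma fps_XD_numeral: "fps_XD (numeral k :: real fps) = 0"
  by (rule fps_ext) (simp add: numeral_fps_const)

lemma fps_XD_ramamani_Q_conv: "fps_XD ramamani_Q = 16 * fps_XD (alt_lambert 3)"
  unfolding ramamani_Q_def fps_XD_add fps_XD_numeral_mult fps_XD_1 by simp

text \<open>Write e = E_6(q), d = E_6(q^2) and h = 1 - 8 \<open>alt_lambert 5\<close>. Three linear
  equations for e, d, h are derived and solved for h.\<close>

lemma alt_lambert_5_eq: "1 - 8 * alt_lambert 5 = ramamani_Q * ramamani_W"
proof -
  have "fps_XD (4 * ramamani_W\<^sup>2) = fps_XD (3 * ramamani_Q + (1 + 240 * power_lambert 3))"
    by (simp only: ramamani_W_square)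
  hence DW: "8 * ramamani_W * fps_XD ramamani_W = 48 * fps_XD (alt_lambert 3) + 240 * fps_XD (power_lambert 3)"
    by (simp add: fps_XD_1 power2_eq_square fps_XD_mult fps_XD_numeral fps_XD_ramamani_Q_conv algebra_simps)
  have S3: "power_lambert 3 * 240 = 4 * ramamani_W\<^sup>2 - 3 * ramamani_Q - 1"
    using ramamani_W_square by (simp add: algebra_simps)
  have A1: "8 * alt_lambert 1 = 1 - ramamani_P" and A3: "16 * alt_lambert 3 = ramamani_Q - 1"
    and S1: "24 * power_lambert 1 = 2 * ramamani_W - 3 * ramamani_P + 1"
    by (simp_all add: ramamani_P_def ramamani_Q_def ramamani_W_def algebra_simps)
  \<comment> \<open>First equation, for e and h: the derivatives of \<open>power_lambert 3\<close>
    and \<open>alt_lambert 3\<close> are eliminated with the help of the differentiated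
    \<open>ramamani_W_square\<close>.\<close>
  have "1 - 504 * power_lambert 5 + 9 * (1 - 8 * alt_lambert 5) =
          18 * ramamani_W * ramamani_Q - 8 * ramamani_W ^ 3"
    using DW fps_XD_ramamani_W power_lambert_ode_3 alt_lambert_ode_3 A1 A3 S1 S3
    by algebra
  \<comment> \<open>Second equation, for d and e: here the linear relation
    \<open>fps_XD_alt_lambert_conv(2)\<close> does the elimination.\<close>
  moreover have "48 * (1 - 504 * fps_double (power_lambert 5)) + (1 - 504 * power_lambert 5) =
          63 * ramamani_W * ramamani_Q - 14 * ramamani_W ^ 3"
    using double_power_lambert_ode_3 power_lambert_ode_3 alt_lambert_ode_3 A1 A3 S1 S3
      alt_lambert_conv fps_XD_alt_lambert_conv(2)
    by algebra
  \<comment> \<open>The third equation is 63 h = 64 d - e.\<close>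
  ultimately show ?thesis
    using alt_lambert_conv(3) by algebra
qed

text \<open>Once \<open>alt_lambert 5\<close> is known, \<open>alt_lambert_ode_3\<close> is a linear
  equation in which \<open>ramamani_Q\<close> factors out.\<close>

lemma fps_XD_ramamani_Q: "fps_XD ramamani_Q = ramamani_Q * (ramamani_P - ramamani_W)"
proof -
  have "8 * alt_lambert 1 = 1 - ramamani_P" "16 * alt_lambert 3 = ramamani_Q - 1"
    by (simp_all add: ramamani_P_def ramamani_Q_def)
  thus ?thesis
    using alt_lambert_5_eq alt_lambert_ode_3 fps_XD_ramamani_Q_conv by algebra
qed

text \<open>Differentiating \<open>alt_lambert_5_eq\<close> gives the derivative in
  \<open>alt_lambert_ode_5\<close>, which is then solved for \<open>alt_lambert 7\<close>; the
  quasimodular \<open>ramamani_P\<close> cancels.\<close>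

lemma alt_lambert_7_eq: "17 + 32 * alt_lambert 7 = ramamani_Q * (9 * ramamani_Q + 8 * ramamani_W\<^sup>2)"
proof -
  have "fps_XD (1 - 8 * alt_lambert 5) = fps_XD (ramamani_Q * ramamani_W)"
    by (simp only: alt_lambert_5_eq)
  hence "- 8 * fps_XD (alt_lambert 5) = fps_XD ramamani_Q * ramamani_W + ramamani_Q * fps_XD ramamani_W"
    by (simp add: fps_XD_1 fps_XD_diff fps_XD_mult fps_XD_numeral)
  moreover have "8 * alt_lambert 1 = 1 - ramamani_P" "16 * alt_lambert 3 = ramamani_Q - 1"
    by (simp_all add: ramamani_P_def ramamani_Q_def)
  ultimately show ?thesis
    using alt_lambert_5_eq alt_lambert_ode_5 fps_XD_ramamani_Q fps_XD_ramamani_W by algebra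
qed

section \<open>Gauss's product for the alternating theta series\<close>

text \<open>Coefficient n of the equation expresses (n - c) times the unknown through lower
  coefficients, so it determines everything beyond index c.\<close>

lemma fps_XD_linear_ode_unique:
  fixes f g F :: "real fps"
  assumes f: "fps_XD f = f * F" and g: "fps_XD g = g * F" and F: "fps_nth F 0 = real c"
    and init: "\<And>i. i \<le> c \<Longrightarrow> fps_nth f i = fps_nth g i"
  shows "f = g"
proof (rule fps_ext)
  fix n
  show "fps_nth f n = fps_nth g n"
  proof (induction n rule: less_induct)
    case (less n)
    show ?case
    proof (cases "n \<le> c")
      case False
      have split: "real n * fps_nth h n = (\<Sum>i<n. fps_nth h i * fps_nth F (n - i)) + fps_nth h n * real c"
        if "fps_XD h = h * F" for h
      proof -
        have "real n * fps_nth h n = fps_nth (h * F) n"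
          by (simp flip: that)
        also have "\<dots> = (\<Sum>i<n. fps_nth h i * fps_nth F (n - i)) + fps_nth h n * real c"
          by (simp add: fps_mult_nth F atLeast0AtMost flip: lessThan_Suc_atMost)
        finally show ?thesis .
      qed
      have "(\<Sum>i<n. fps_nth f i * fps_nth F (n - i)) = (\<Sum>i<n. fps_nth g i * fps_nth F (n - i))"
        by (intro sum.cong) (auto simp: less)
      hence "(real n - real c) * fps_nth f n = (real n - real c) * fps_nth g n"
        using split[OF f] split[OF g] by (simp add: algebra_simps)
      thus ?thesis using False by simp
    qed (simp add: init)
  qed
qed

text \<open>Additivity of logarithmic derivatives, stated without division.\<close>

lemma fps_XD_prod:
  fixes f g :: "'b \<Rightarrow> 'a :: comm_ring_1 fps"
  assumes "\<And>k. k \<in> A \<Longrightarrow> fps_XD (f k) = f k * g k"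
  shows "fps_XD (\<Prod>k\<in>A. f k) = (\<Prod>k\<in>A. f k) * (\<Sum>k\<in>A. g k)"
  using assms
  by (induction A rule: infinite_finite_induct)
     (simp_all add: fps_XD_1 fps_XD_mult algebra_simps)

lemma fps_XD_power:
  fixes f g :: "'a :: comm_ring_1 fps"
  assumes "fps_XD f = f * g"
  shows "fps_XD (f ^ k) = f ^ k * (of_nat k * g)"
  using fps_XD_prod[of "{..<k}" "\<lambda>_. f" "\<lambda>_. g"] assms by simp

text \<open>Shanks' finite form of Gauss's product for the alternating theta series: all terms
  of the sum other than \<open>s = 0\<close>, which is the partial product itself, are divisible by \<open>X ^ (n + 1)\<close>.\<close>

definition gauss_prod :: "nat \<Rightarrow> real fps" where
  "gauss_prod n = (\<Prod>k=1..n. (1 - fps_X ^ k) * inverse (1 + fps_X ^ k))"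

text \<open>The last factor is 1 for s = 0, because 1 + X^0 = 2; this avoids a case
  distinction.\<close>

definition shanks_term :: "nat \<Rightarrow> nat \<Rightarrow> real fps" where
  "shanks_term n s = (-1) ^ s * gauss_prod n * inverse (gauss_prod s) * fps_X ^ (s * (n + 1)) *
     (2 * inverse (1 + fps_X ^ s))"

lemma inverse_one_plus_X_power: "inverse (1 + fps_X ^ s) * (1 + fps_X ^ s :: real fps) = 1"
  by (rule inverse_mult_eq_1) (simp add: fps_X_power_nth)

lemma gauss_prod_Suc:
  "gauss_prod (Suc n) = gauss_prod n * ((1 - fps_X ^ Suc n) * inverse (1 + fps_X ^ Suc n))"
  by (simp add: gauss_prod_def)

lemma gauss_prod_nth_0: "fps_nth (gauss_prod n) 0 = 1"
  by (induction n) (simp_all add: gauss_prod_Suc, simp add: gauss_prod_def)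

lemma inverse_gauss_prod: "inverse (gauss_prod n) * gauss_prod n = 1"
  by (rule inverse_mult_eq_1) (simp add: gauss_prod_nth_0)

lemma inverse_gauss_prod_conv_Suc:
  "inverse (gauss_prod n) =
     inverse (gauss_prod (Suc n)) * ((1 - fps_X ^ Suc n) * inverse (1 + fps_X ^ Suc n))"
proof -
  have "i = I * t" if "i * p = 1" "I * (p * t) = 1" for i I p t :: "real fps"
    using that by algebra
  from this[OF inverse_gauss_prod inverse_gauss_prod[of "Suc n", unfolded gauss_prod_Suc]]
  show ?thesis unfolding gauss_prod_Suc .
qed

text \<open>The step from m to m + 1 changes the partial sums by a single product, so induction on j
  telescopes. At j = m the two Gauss products cancel and the exponent is (m + 1)^2.\<close>

lemma sum_shanks_term_diff:
  "(\<Sum>s\<le>j. shanks_term (Suc m) s - shanks_term m s) =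
     2 * (-1) ^ Suc j * fps_X ^ (Suc j * Suc m) * gauss_prod m * inverse (gauss_prod j) *
     inverse (1 + fps_X ^ Suc m)"
proof (induction j)
  case 0
  define p z w :: "real fps" where "p = gauss_prod m" and "z = fps_X ^ Suc m" and "w = inverse (1 + z)"
  have w: "w * (1 + z) = 1"
    unfolding w_def z_def by (rule inverse_one_plus_X_power)
  have two: "inverse (2 :: real fps) * 2 = 1"
    by (rule inverse_mult_eq_1) simp
  have "p * ((1 - z) * w) * (inverse 2 * 2) - p * (inverse 2 * 2) = - 2 * z * p * w"
    unfolding two using w by algebra
  thus ?case
    by (simp add: shanks_term_def gauss_prod_Suc gauss_prod_def[of 0] p_def z_def w_def algebra_simps)
next
  case (Suc j)
  define p r z w x y Z e :: "real fps" where
    "p = gauss_prod m" and "r = inverse (gauss_prod (Suc j))" and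
    "z = fps_X ^ Suc m" and "w = inverse (1 + z)" and "x = fps_X ^ Suc j" and
    "y = inverse (1 + x)" and "Z = fps_X ^ (Suc j * Suc m)" and "e = (-1) ^ Suc j"
  have w: "w * (1 + z) = 1" and y: "y * (1 + x) = 1"
    unfolding w_def z_def x_def y_def by (rule inverse_one_plus_X_power)+
  have X: "fps_X ^ (Suc j * (Suc m + 1)) = Z * x" "fps_X ^ (Suc j * (m + 1)) = Z"
    "fps_X ^ (Suc (Suc j) * Suc m) = Z * z"
    unfolding Z_def x_def z_def power_add[symmetric] by (simp_all add: algebra_simps)
  have "(\<Sum>s\<le>Suc j. shanks_term (Suc m) s - shanks_term m s) =
        2 * e * Z * p * (r * ((1 - x) * y)) * w +
        (e * (p * ((1 - z) * w)) * r * (Z * x) * (2 * y) - e * p * r * Z * (2 * y))"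
    unfolding sum.atMost_Suc Suc.IH unfolding shanks_term_def X inverse_gauss_prod_conv_Suc[of j] gauss_prod_Suc[of m]
    unfolding p_def r_def z_def w_def x_def y_def Z_def e_def ..
  also have "\<dots> = 2 * (- e) * (Z * z) * p * r * w"
    using w y by algebra
  also have "\<dots> = 2 * (-1) ^ Suc (Suc j) * fps_X ^ (Suc (Suc j) * Suc m) * gauss_prod m *
      inverse (gauss_prod (Suc j)) * inverse (1 + fps_X ^ Suc m)"
    unfolding X unfolding p_def r_def z_def w_def e_def by simp
  finally show ?case .
qed

text \<open>The accumulated change and the new term s = m + 1 differ by the factor z = X^(m + 1);
  together they carry w (1 + z) = 1, which leaves the new theta term.\<close>

lemma shanks_identity:
  "(\<Sum>s\<le>n. shanks_term n s) = 1 + (\<Sum>s=1..n. 2 * (-1) ^ s * fps_X ^ (s ^ 2))"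
proof (induction n)
  case 0
  have "inverse (2 :: real fps) * 2 = 1"
    by (rule inverse_mult_eq_1) simp
  thus ?case by (simp add: shanks_term_def gauss_prod_def mult.commute)
next
  case (Suc m)
  define z w :: "real fps" where "z = fps_X ^ Suc m" and "w = inverse (1 + z)"
  have w: "w * (1 + z) = 1"
    unfolding w_def z_def by (rule inverse_one_plus_X_power)
  have *: "inverse (gauss_prod k) * gauss_prod k = 1" "gauss_prod k * inverse (gauss_prod k) = 1" for k
    using inverse_gauss_prod[of k] by (simp_all add: mult.commute)
  have "(\<Sum>s\<le>Suc m. shanks_term (Suc m) s) =
        (\<Sum>s\<le>m. shanks_term (Suc m) s - shanks_term m s) + (\<Sum>s\<le>m. shanks_term m s) + shanks_term (Suc m) (Suc m)"
    by (simp add: sum_subtractf)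
  also have "(\<Sum>s\<le>m. shanks_term (Suc m) s - shanks_term m s) =
             2 * (-1) ^ Suc m * fps_X ^ (Suc m ^ 2) * w"
    unfolding sum_shanks_term_diff by (simp add: * w_def z_def power2_eq_square mult.assoc)
  also have "shanks_term (Suc m) (Suc m) = 2 * (-1) ^ Suc m * fps_X ^ (Suc m ^ 2) * z * w"
  proof -
    have "fps_X ^ (Suc m * (Suc m + 1)) = (fps_X ^ (Suc m ^ 2) * z :: real fps)"
      unfolding z_def power_add[symmetric] by (simp add: power2_eq_square)
    thus ?thesis
      unfolding shanks_term_def mult.assoc[of _ "gauss_prod (Suc m)"] * w_def z_def by simp
  qed
  also have "2 * (-1) ^ Suc m * fps_X ^ (Suc m ^ 2) * w + (\<Sum>s\<le>m. shanks_term m s) +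
      2 * (-1) ^ Suc m * fps_X ^ (Suc m ^ 2) * z * w =
      (\<Sum>s\<le>m. shanks_term m s) + 2 * (-1) ^ Suc m * fps_X ^ (Suc m ^ 2) * (w * (1 + z))"
    by (simp add: algebra_simps)
  finally show ?case
    unfolding w Suc.IH by simp
qed

section \<open>The theta series as limit of Gauss's partial products\<close>

definition square_roots :: "nat \<Rightarrow> int set" where
  "square_roots n = {x. x\<^sup>2 = int n}"

text \<open>Equals the sum of (-1)^x q^(x^2) over integers x, since x and x^2 have equal parity.
  Counting roots makes its powers count sums of squares.\<close>

definition alt_theta :: "real fps" where
  "alt_theta = Abs_fps (\<lambda>n. (-1) ^ n * real (card (square_roots n)))"

lemma square_roots_square: "square_roots (m\<^sup>2) = {int m, - int m}"
  by (auto simp: square_roots_def power2_eq_iff)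

lemma square_roots_nonempty:
  assumes "x \<in> square_roots n"
  shows "n = (nat \<bar>x\<bar>)\<^sup>2"
proof -
  have "int n = int ((nat \<bar>x\<bar>)\<^sup>2)"
    using assms by (simp add: square_roots_def)
  thus ?thesis by (simp only: of_nat_eq_iff)
qed

lemma finite_square_roots: "finite (square_roots n)"
proof (cases "square_roots n = {}")
  case False
  then obtain x where "n = (nat \<bar>x\<bar>)\<^sup>2" using square_roots_nonempty by blast
  thus ?thesis by (metis square_roots_square finite.emptyI finite_insert)
qed simp

lemma alt_theta_nth:
  assumes "i \<le> n"
  shows "fps_nth alt_theta i = fps_nth (1 + (\<Sum>s=1..n. 2 * (-1) ^ s * fps_X ^ (s ^ 2))) i"
proof -
  have "(2 * (-1) ^ s * fps_X ^ (s ^ 2) :: real fps) = fps_const (2 * (-1) ^ s) * fps_X ^ (s ^ 2)" for s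
    by (simp flip: numeral_fps_const fps_const_mult fps_const_power fps_const_neg)
  hence rhs: "fps_nth (1 + (\<Sum>s=1..n. 2 * (-1) ^ s * fps_X ^ (s ^ 2))) i =
      (if i = 0 then 1 else 0) + (\<Sum>s=1..n. if i = s\<^sup>2 then 2 * (-1) ^ s else (0 :: real))"
    by (simp only: fps_add_nth fps_sum_nth fps_mult_left_const_nth fps_X_power_nth fps_one_nth)
       (simp add: if_distrib cong: if_cong)
  show ?thesis
  proof (cases "square_roots i = {}")
    case True
    hence "i \<noteq> s\<^sup>2" for s
      using square_roots_square[of s] by auto
    hence "i \<noteq> 0" "(\<Sum>s=1..n. if i = s\<^sup>2 then 2 * (-1) ^ s else (0 :: real)) = 0"
      by (metis zero_power2, simp)
    thus ?thesis unfolding rhs using True by (simp add: alt_theta_def)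
  next
    case False
    then obtain m where m: "i = m\<^sup>2" using square_roots_nonempty by blast
    show ?thesis
    proof (cases "m = 0")
      case False
      have "m \<le> n" using assms m self_le_power[of m 2] False by linarith
      have "(\<Sum>s=1..n. if i = s\<^sup>2 then 2 * (-1) ^ s else (0 :: real)) =
            (\<Sum>s=1..n. if s = m then 2 * (-1) ^ s else 0)"
        using m by (intro sum.cong) auto
      also have "\<dots> = 2 * (-1) ^ m"
        using False \<open>m \<le> n\<close> by simp
      finally have sum: "(\<Sum>s=1..n. if i = s\<^sup>2 then 2 * (-1) ^ s else (0 :: real)) = 2 * (-1) ^ m" .
      have "card (square_roots i) = 2"
        using False by (simp add: m square_roots_square card_insert_if)
      moreover have "(-1) ^ i = ((-1) ^ m :: real)"
        using m by (cases "even m") auto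
      ultimately show ?thesis
        unfolding rhs sum using False m by (simp add: alt_theta_def)
    next
      case True
      thus ?thesis
        unfolding rhs using m square_roots_square[of 0] by (simp add: alt_theta_def)
    qed
  qed
qed

lemma shanks_term_nth_eq_0:
  assumes "i \<le> n" "s > 0"
  shows "fps_nth (shanks_term n s) i = 0"
proof -
  have "shanks_term n s = fps_X ^ (s * (n + 1)) *
      ((-1) ^ s * gauss_prod n * inverse (gauss_prod s) * (2 * inverse (1 + fps_X ^ s)))"
    by (simp only: shanks_term_def mult_ac)
  moreover have "i < s * (n + 1)"
    using assms by (cases s) auto
  ultimately show ?thesis
    by (simp only: fps_X_power_mult_nth if_True)
qed

lemma alt_theta_nth_conv_gauss_prod:
  assumes "i \<le> n"
  shows "fps_nth alt_theta i = fps_nth (gauss_prod n) i"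
proof -
  have "inverse (2 :: real fps) * 2 = 1"
    by (rule inverse_mult_eq_1) simp
  hence 0: "shanks_term n 0 = gauss_prod n"
    by (simp add: shanks_term_def gauss_prod_def[of 0] mult.commute)
  have "fps_nth alt_theta i = (\<Sum>s\<le>n. fps_nth (shanks_term n s) i)"
    unfolding alt_theta_nth[OF assms] shanks_identity[symmetric] by (simp add: fps_sum_nth)
  also have "\<dots> = (\<Sum>s\<in>{0}. fps_nth (shanks_term n s) i)"
    using assms by (intro sum.mono_neutral_right) (auto simp: shanks_term_nth_eq_0)
  finally show ?thesis by (simp add: 0)
qed

section \<open>The logarithmic derivative of the theta series\<close>

lemma lambert_term_double: "lambert_term (2 * k) = fps_double (lambert_term k)"
  by (rule fps_ext) (auto simp: fps_double_nth lambert_term_def elim!: evenE)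

text \<open>With x = X^k the factor (1 - x) / (1 + x) has logarithmic derivative -k (x / (1 - x) + x
  / (1 + x)), and x / (1 + x) = x / (1 - x) - 2 x^2 / (1 - x^2).\<close>

lemma fps_XD_gauss_prod:
  "fps_XD (gauss_prod n) =
     gauss_prod n * (\<Sum>k=1..n. of_nat k * (2 * fps_double (lambert_term k) - 2 * lambert_term k))"
  unfolding gauss_prod_def
proof (rule fps_XD_prod)
  fix k assume "k \<in> {1..n}"
  hence k: "k > 0" by simp
  define x v u U :: "real fps" where
    "x = fps_X ^ k" and "v = inverse (1 + x)" and "u = lambert_term k" and "U = fps_double u"
  have v: "v * (1 + x) = 1"
    unfolding v_def x_def by (rule inverse_one_plus_X_power)
  have u: "(1 - x) * u = x"
    unfolding x_def u_def by (rule lambert_term_eq[OF k])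
  have "(1 - fps_X ^ (2 * k)) * U = fps_X ^ (2 * k)"
    unfolding U_def u_def lambert_term_double[symmetric] using k by (intro lambert_term_eq) simp
  hence U: "(1 - x ^ 2) * U = x ^ 2"
    by (simp add: x_def power_mult mult.commute)
  have x: "fps_XD x = of_nat k * x"
    unfolding x_def by (rule fps_XD_X_power)
  have "fps_XD (v * (1 + x)) = 0"
    by (simp add: v fps_XD_1)
  hence "fps_XD v * (1 + x) + v * (of_nat k * x) = 0"
    by (simp add: fps_XD_mult fps_XD_1 x)
  hence "(1 - x) * fps_XD v - of_nat k * x * v = (1 - x) * v * (of_nat k * (2 * U - 2 * u))"
    using v u U by algebra
  thus "fps_XD ((1 - fps_X ^ k) * inverse (1 + fps_X ^ k)) =
      (1 - fps_X ^ k) * inverse (1 + fps_X ^ k) *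
      (of_nat k * (2 * fps_double (lambert_term k) - 2 * lambert_term k))"
    unfolding fps_XD_mult fps_XD_diff fps_XD_1 fps_XD_X_power
    unfolding x_def[symmetric] u_def[symmetric]
    unfolding v_def[symmetric] U_def[symmetric] by (simp add: algebra_simps)
qed

lemma fps_XD_alt_theta:
  "fps_XD alt_theta = alt_theta * (2 * fps_double (power_lambert 1) - 2 * power_lambert 1)"
proof (rule fps_ext)
  fix n
  let ?S = "\<Sum>k=1..n. of_nat k * (2 * fps_double (lambert_term k) - 2 * lambert_term k)"
  have S: "fps_nth ?S i = fps_nth (2 * fps_double (power_lambert 1) - 2 * power_lambert 1) i"
    if "i \<le> n" for i
  proof -
    have "i div 2 \<le> n" using that by simp
    thus ?thesis
      using that
      by (simp add: power_lambert_def fps_double_nth lambert_nth[of _ n] fps_sum_nth numeral_fps_const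
            sum_subtractf sum_distrib_left algebra_simps flip: fps_of_nat)
  qed
  have "fps_nth (fps_XD alt_theta) n = fps_nth (fps_XD (gauss_prod n)) n"
    by (simp add: alt_theta_nth_conv_gauss_prod[of n n])
  also have "\<dots> = fps_nth (alt_theta * (2 * fps_double (power_lambert 1) - 2 * power_lambert 1)) n"
    unfolding fps_XD_gauss_prod
    by (rule fps_mult_nth_cong) (simp only: alt_theta_nth_conv_gauss_prod, rule S)
  finally show "fps_nth (fps_XD alt_theta) n = \<dots>" .
qed

lemma fps_nth_lambert_0: "fps_nth (lambert f) 0 = 0"
  and fps_nth_lambert_1: "fps_nth (lambert f) 1 = f 1"
  by (simp_all add: lambert_def)

lemma fps_numeral_mult_nth: "fps_nth (numeral k * f) n = numeral k * fps_nth (f :: real fps) n"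
  by (simp add: numeral_fps_const)

lemma ramamani_nth_0_1:
  "fps_nth ramamani_Q 0 = 1" "fps_nth ramamani_Q 1 = - 16"
  "fps_nth ramamani_W 0 = 1" "fps_nth ramamani_W 1 = 24"
  unfolding ramamani_Q_def ramamani_W_def alt_lambert_def power_lambert_def
  by (simp_all add: fps_numeral_mult_nth fps_nth_lambert_0 fps_nth_lambert_1[unfolded One_nat_def])

text \<open>Both sides have logarithmic derivative \<open>ramamani_P - ramamani_W\<close>, whose
  constant term is 0; comparing constant coefficients therefore suffices.\<close>

lemma alt_theta_power_8: "alt_theta ^ 8 = ramamani_Q"
proof (rule fps_XD_linear_ode_unique)
  have "of_nat 8 * (2 * fps_double (power_lambert 1) - 2 * power_lambert 1) = ramamani_P - ramamani_W"
    unfolding ramamani_P_def ramamani_W_def alt_lambert_conv(1) by simp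
  thus "fps_XD (alt_theta ^ 8) = alt_theta ^ 8 * (ramamani_P - ramamani_W)"
    using fps_XD_power[OF fps_XD_alt_theta, of 8] by simp
  show "fps_XD ramamani_Q = ramamani_Q * (ramamani_P - ramamani_W)"
    by (rule fps_XD_ramamani_Q)
  show "fps_nth (ramamani_P - ramamani_W) 0 = real 0"
    by (simp add: ramamani_nth_0_1, simp add: ramamani_P_def alt_lambert_def fps_nth_lambert_0)
  show "fps_nth (alt_theta ^ 8) i = fps_nth ramamani_Q i" if "i \<le> 0" for i
    using that alt_theta_nth_conv_gauss_prod[of 0 0]
    by (simp add: ramamani_nth_0_1 gauss_prod_nth_0 fps_nth_power_0)
qed

section \<open>The discriminant\<close>

definition fps_real_of_int :: "int fps \<Rightarrow> real fps" where
  "fps_real_of_int f = Abs_fps (\<lambda>n. real_of_int (fps_nth f n))"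

lemma fps_real_of_int_hom:
  "fps_real_of_int 1 = 1"
  "fps_real_of_int fps_X = fps_X"
  "fps_real_of_int (f - g) = fps_real_of_int f - fps_real_of_int g"
  "fps_real_of_int (f * g) = fps_real_of_int f * fps_real_of_int g"
  by (rule fps_ext; simp add: fps_real_of_int_def fps_mult_nth fps_X_def)+

lemma fps_real_of_int_power: "fps_real_of_int (f ^ k) = fps_real_of_int f ^ k"
  by (induction k) (simp_all add: fps_real_of_int_hom)

lemma fps_real_of_int_prod: "fps_real_of_int (\<Prod>k\<in>A. f k) = (\<Prod>k\<in>A. fps_real_of_int (f k))"
  by (induction A rule: infinite_finite_induct) (simp_all add: fps_real_of_int_hom)

definition delta_partial :: "nat \<Rightarrow> real fps" where
  "delta_partial N = fps_X * (\<Prod>k=1..N. (1 - fps_X ^ k) ^ 24)"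

text \<open>Convergence of a product allows dropping the first M factors. The head C is put back;
  nonzero factors in a domain keep C p nonzero, so C p is the value of the product.\<close>

lemma fps_prodinf_LIMSEQ:
  fixes f :: "nat \<Rightarrow> 'a :: idom fps"
  assumes "convergent_prod f" and nz: "\<And>k. f k \<noteq> 0"
  shows "(\<lambda>n. \<Prod>k\<le>n. f k) \<longlonglongrightarrow> prodinf f"
proof -
  obtain M p where p: "(\<lambda>n. \<Prod>i\<le>n. f (i + M)) \<longlonglongrightarrow> p" "p \<noteq> 0"
    using assms(1) unfolding convergent_prod_def raw_has_prod_def by blast
  define C where "C = (\<Prod>k<M. f k)"
  have "(\<Prod>k<n + M. f k) = C * (\<Prod>i<n. f (i + M))" for n
    by (induction n) (simp_all add: C_def mult_ac)
  from this[of "Suc _"] have split: "(\<Prod>k\<le>n + M. f k) = C * (\<Prod>i\<le>n. f (i + M))" for n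
    by (simp only: add_Suc lessThan_Suc_atMost)
  have "(\<lambda>n. \<Prod>k\<le>n + M. f k) \<longlonglongrightarrow> C * p"
    unfolding split
  proof (rule tendsto_fpsI)
    fix i
    have "eventually (\<lambda>n. \<forall>j\<in>{..i}. fps_nth (\<Prod>i\<le>n. f (i + M)) j = fps_nth p j) sequentially"
      using p(1) unfolding tendsto_fps_iff by (intro eventually_ball_finite) auto
    thus "eventually (\<lambda>n. fps_nth (C * (\<Prod>i\<le>n. f (i + M))) i = fps_nth (C * p) i) sequentially"
      by eventually_elim (rule fps_mult_nth_cong, auto)
  qed
  hence lim: "(\<lambda>n. \<Prod>k\<le>n. f k) \<longlonglongrightarrow> C * p"
    by (rule LIMSEQ_offset)
  moreover have "C * p \<noteq> 0"
    using p(2) nz by (simp add: C_def)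
  ultimately have "f has_prod (C * p)"
    by (simp add: has_prod_def raw_has_prod_def)
  with lim show ?thesis
    using has_prod_unique by metis
qed

text \<open>Each coefficient is eventually constant, and finitely many of them share one
  bound.\<close>

lemma ramanujan_tau_conv_delta_partial:
  obtains N where "N \<ge> n" "\<And>i. i \<le> n \<Longrightarrow> real_of_int (ramanujan_tau i) = fps_nth (delta_partial N) i"
proof -
  let ?f = "\<lambda>k. (1 - fps_X ^ Suc k :: int fps) ^ 24"
  have "(\<lambda>N. \<Prod>k\<le>N. ?f k) \<longlonglongrightarrow> (\<Prod>k. ?f k)"
  proof (rule fps_prodinf_LIMSEQ)
    show "?f k \<noteq> 0" for k
      by (rule fps_nonzeroI[of _ 0]) (simp add: fps_nth_power_0)
  qed (rule convergent_prod_tau)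
  hence "eventually (\<lambda>N. fps_nth (\<Prod>k\<le>N. ?f k) i = fps_nth (\<Prod>k. ?f k) i) sequentially" for i
    unfolding tendsto_fps_iff by blast
  hence "eventually (\<lambda>N. \<forall>i\<in>{..n}. fps_nth (\<Prod>k\<le>N. ?f k) i = fps_nth (\<Prod>k. ?f k) i) sequentially"
    by (intro eventually_ball_finite) auto
  hence "eventually (\<lambda>N. N \<ge> n \<and> (\<forall>i\<in>{..n}. fps_nth (\<Prod>k\<le>N. ?f k) i = fps_nth (\<Prod>k. ?f k) i)) sequentially"
    using eventually_ge_at_top[of n] by eventually_elim auto
  then obtain N where N: "N \<ge> n" "\<And>i. i \<le> n \<Longrightarrow> fps_nth (\<Prod>k\<le>N. ?f k) i = fps_nth (\<Prod>k. ?f k) i"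
    unfolding eventually_sequentially by auto
  have "delta_partial (Suc N) = fps_X * (\<Prod>k\<le>N. (1 - fps_X ^ Suc k) ^ 24)"
    unfolding delta_partial_def
    by (intro arg_cong2[where f = "(*)"] refl prod.reindex_bij_witness[of _ Suc "\<lambda>k. k - 1"]) auto
  also have "\<dots> = fps_real_of_int (fps_X * (\<Prod>k\<le>N. ?f k))"
    unfolding fps_real_of_int_hom fps_real_of_int_prod fps_real_of_int_power ..
  finally have dp: "delta_partial (Suc N) = \<dots>" .
  have "real_of_int (ramanujan_tau i) = fps_nth (delta_partial (Suc N)) i" if "i \<le> n" for i
  proof -
    have "ramanujan_tau i = fps_nth (fps_X * (\<Prod>k\<le>N. ?f k)) i"
      unfolding ramanujan_tau_def by (rule fps_mult_nth_cong) (use N that in simp_all)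
    thus ?thesis unfolding dp by (simp add: fps_real_of_int_def)
  qed
  with N(1) show ?thesis by (intro that[of "Suc N"]) auto
qed

text \<open>The leading X contributes 1 and each factor (1 - X^k)^24 contributes -24 k X^k / (1 -
  X^k).\<close>

lemma fps_XD_delta_partial:
  "fps_XD (delta_partial N) = delta_partial N * (1 - (\<Sum>k=1..N. of_nat k * (24 * lambert_term k)))"
proof -
  have "fps_XD ((1 - fps_X ^ k) ^ 24 :: real fps) =
        (1 - fps_X ^ k) ^ 24 * (of_nat 24 * (- (of_nat k * lambert_term k)))" if "k \<in> {1..N}" for k
  proof (rule fps_XD_power)
    have "(1 - fps_X ^ k) * lambert_term k = fps_X ^ k"
      using that by (intro lambert_term_eq) simp
    thus "fps_XD (1 - fps_X ^ k) = (1 - fps_X ^ k) * - (of_nat k * lambert_term k)"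
      unfolding fps_XD_diff fps_XD_1 fps_XD_X_power by (simp add: mult.left_commute)
  qed
  hence "fps_XD (\<Prod>k=1..N. (1 - fps_X ^ k) ^ 24 :: real fps) =
         (\<Prod>k=1..N. (1 - fps_X ^ k) ^ 24) * (\<Sum>k=1..N. of_nat 24 * (- (of_nat k * lambert_term k)))"
    by (rule fps_XD_prod)
  also have "(\<Sum>k=1..N. of_nat 24 * (- (of_nat k * lambert_term k))) =
             - (\<Sum>k=1..N. of_nat k * (24 * lambert_term k))"
    by (simp add: sum_negf mult_ac)
  finally show ?thesis
    using fps_XD_X_power[of 1, where ?'a = real]
    unfolding delta_partial_def fps_XD_mult by (simp add: algebra_simps)
qed

definition delta :: "real fps" where
  "delta = Abs_fps (\<lambda>n. real_of_int (ramanujan_tau n))"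

lemma fps_XD_delta: "fps_XD delta = delta * eis_P"
proof (rule fps_ext)
  fix n
  obtain N where N: "N \<ge> n" "\<And>i. i \<le> n \<Longrightarrow> fps_nth delta i = fps_nth (delta_partial N) i"
    using ramanujan_tau_conv_delta_partial[of n] unfolding delta_def by auto
  have "fps_nth (fps_XD delta) n = fps_nth (fps_XD (delta_partial N)) n"
    by (simp add: N)
  also have "\<dots> = fps_nth (delta * eis_P) n"
    unfolding fps_XD_delta_partial
  proof (rule fps_mult_nth_cong)
    show "fps_nth (1 - (\<Sum>k=1..N. of_nat k * (24 * lambert_term k))) i = fps_nth eis_P i" if "i \<le> n" for i
      using that N(1)
      by (simp add: eis_P_def power_lambert_def lambert_nth[of i N] fps_sum_nth numeral_fps_const
            sum_distrib_left mult_ac flip: fps_of_nat)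
  qed (simp add: N)
  finally show "fps_nth (fps_XD delta) n = \<dots>" .
qed

lemma delta_nth_0_1: "fps_nth delta 0 = 0" "fps_nth delta 1 = 1"
proof -
  obtain N where "\<And>i. i \<le> 1 \<Longrightarrow> fps_nth delta i = fps_nth (delta_partial N) i"
    using ramanujan_tau_conv_delta_partial[of 1] unfolding delta_def by auto
  moreover have "fps_nth (\<Prod>k=1..N. (1 - fps_X ^ k) ^ 24 :: real fps) 0 = 1"
    by (induction N) (simp_all add: fps_nth_power_0)
  ultimately show "fps_nth delta 0 = 0" "fps_nth delta 1 = 1"
    by (simp_all add: delta_partial_def)
qed

text \<open>Both sides have logarithmic derivative E_2 = 3 \<open>ramamani_P\<close> - 2
  \<open>ramamani_W\<close>: the square of \<open>ramamani_Q\<close> contributes 2 (P - W) and W^2 -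
  Q contributes P.\<close>

lemma delta_eq: "64 * delta = ramamani_Q\<^sup>2 * (ramamani_W\<^sup>2 - ramamani_Q)"
proof (rule fps_XD_linear_ode_unique)
  show "fps_XD (64 * delta) = 64 * delta * eis_P"
    by (simp add: fps_XD_numeral_mult fps_XD_delta mult.assoc)
  have P: "eis_P = 3 * ramamani_P - 2 * ramamani_W"
    by (simp add: eis_P_def ramamani_P_def ramamani_W_def)
  show "fps_XD (ramamani_Q\<^sup>2 * (ramamani_W\<^sup>2 - ramamani_Q)) =
          ramamani_Q\<^sup>2 * (ramamani_W\<^sup>2 - ramamani_Q) * eis_P"
    unfolding power2_eq_square fps_XD_mult fps_XD_diff
    using fps_XD_ramamani_Q fps_XD_ramamani_W P by algebra
  show "fps_nth eis_P 0 = real 1"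
    by (simp add: eis_P_def power_lambert_def fps_nth_lambert_0)
  \<comment> \<open>The constant term of E_2 is 1, so degrees 0 and 1 must be compared; in degree 1
    the right side is 2 * 24 + 16 = 64.\<close>
  show "fps_nth (64 * delta) i = fps_nth (ramamani_Q\<^sup>2 * (ramamani_W\<^sup>2 - ramamani_Q)) i"
    if "i \<le> 1" for i
  proof -
    from that consider "i = 0" | "i = 1" by linarith
    thus ?thesis
      by cases (use delta_nth_0_1 ramamani_nth_0_1 in
        \<open>simp_all add: fps_numeral_mult_nth power2_eq_square\<close>)
  qed
qed

section \<open>Sums of 24 squares\<close>

lemma sum_squares_count_0: "sum_squares_count 0 n = (if n = 0 then 1 else 0)"
proof -
  have "{m :: int list. length m = 0 \<and> (\<Sum>x\<leftarrow>m. x\<^sup>2) = int n} = (if n = 0 then {[]} else {})"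
    by auto
  thus ?thesis by (simp add: sum_squares_count_def)
qed

text \<open>Splitting off the first entry x with x^2 = i gives the convolution that matches one more
  theta factor.\<close>

lemma sum_squares_count_Suc:
  "sum_squares_count (Suc k) n = (\<Sum>i=0..n. card (square_roots i) * sum_squares_count k (n - i))"
proof -
  let ?B = "\<lambda>k n. {m :: int list. length m = k \<and> (\<Sum>x\<leftarrow>m. x\<^sup>2) = int n}"
  let ?S = "SIGMA i:{0..n}. square_roots i \<times> ?B k (n - i)"
  have "bij_betw (\<lambda>(i, x, xs). x # xs) ?S (?B (Suc k) n)"
  proof (rule bij_betw_byWitness[where f' = "\<lambda>m. (nat ((hd m)\<^sup>2), hd m, tl m)"])
    show "(\<lambda>m. (nat ((hd m)\<^sup>2), hd m, tl m)) ` ?B (Suc k) n \<subseteq> ?S"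
    proof (intro image_subsetI)
      fix m assume m: "m \<in> ?B (Suc k) n"
      then obtain x xs where xs: "m = x # xs" "length xs = k"
        by (auto simp: length_Suc_conv)
      hence sum: "x\<^sup>2 + (\<Sum>x\<leftarrow>xs. x\<^sup>2) = int n" using m by simp
      moreover have "(\<Sum>x\<leftarrow>xs. x\<^sup>2) \<ge> 0" by (rule sum_list_nonneg) auto
      ultimately have "x\<^sup>2 \<le> int n" by linarith
      thus "(nat ((hd m)\<^sup>2), hd m, tl m) \<in> ?S"
        using xs sum by (auto simp: square_roots_def of_nat_diff nat_le_iff)
    qed
  qed (auto simp: square_roots_def length_Suc_conv of_nat_diff)
  hence "card (?B (Suc k) n) = card ?S"
    using bij_betw_same_card by fastforce
  also have "\<dots> = (\<Sum>i=0..n. card (square_roots i \<times> ?B k (n - i)))"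
    by (intro card_SigmaI finite_atLeastAtMost ballI finite_cartesian_product
          finite_square_roots finite_sum_squares)
  finally show ?thesis
    by (simp add: sum_squares_count_def card_cartesian_product)
qed

lemma alt_theta_power_nth:
  "fps_nth (alt_theta ^ k) n = (-1) ^ n * real (sum_squares_count k n)"
proof (induction k arbitrary: n)
  case (Suc k)
  have "fps_nth (alt_theta ^ Suc k) n =
        (\<Sum>i=0..n. ((-1) ^ i * (-1) ^ (n - i)) * (real (card (square_roots i)) * real (sum_squares_count k (n - i))))"
    unfolding power_Suc fps_mult_nth Suc.IH by (simp add: alt_theta_def mult_ac)
  also have "\<dots> = (\<Sum>i=0..n. (-1) ^ n * (real (card (square_roots i)) * real (sum_squares_count k (n - i))))"
    by (intro sum.cong refl arg_cong2[where f = "(*)"]) (simp flip: power_add)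
  finally show ?case
    by (simp add: sum_squares_count_Suc sum_distrib_left)
qed (simp add: sum_squares_count_0)

lemma sum_sigma_star_conv:
  "(\<Sum>j=0..n. sigma_star s j * sigma_star t (n - j)) =
     fps_nth (Abs_fps (sigma_star s) * Abs_fps (sigma_star t)) n"
  by (simp add: fps_mult_nth)

text \<open>The conventional values at 0 are exactly the constant terms needed: 1/8, -1/16 and
  -17/32.\<close>

lemma sigma_star_fps:
  "8 * Abs_fps (sigma_star 5) = 1 - 8 * alt_lambert 5"
  "16 * Abs_fps (sigma_star 3) = - (1 + 16 * alt_lambert 3)"
  "32 * Abs_fps (sigma_star 7) = - (17 + 32 * alt_lambert 7)"
  by (rule fps_ext; simp add: fps_numeral_mult_nth alt_lambert_def lambert_def sigma_star_def numeral_fps_const)+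

theorem theorem4p17:
  fixes n :: nat
  shows "real (sum_squares_count 24 n) =
           (-1) ^ n * 64 *
           ((\<Sum>j=0..n. sigma_star 5 j * sigma_star 5 (n - j)) - real_of_int (ramanujan_tau n))
       \<and> real (sum_squares_count 24 n) =
           (-1) ^ n * (512 / 17) *
           ((\<Sum>j=0..n. sigma_star 3 j * sigma_star 7 (n - j)) - real_of_int (ramanujan_tau n))"
proof -
  define G3 G5 G7 where "G3 = Abs_fps (sigma_star 3)" and "G5 = Abs_fps (sigma_star 5)"
    and "G7 = Abs_fps (sigma_star 7)"
  have G: "8 * G5 = ramamani_Q * ramamani_W" "16 * G3 = - ramamani_Q"
    "32 * G7 = - (ramamani_Q * (9 * ramamani_Q + 8 * ramamani_W\<^sup>2))"
    unfolding G3_def G5_def G7_def sigma_star_fps alt_lambert_5_eq alt_lambert_7_eq ramamani_Q_def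
    by simp_all
  have "alt_theta ^ 24 = (alt_theta ^ 8) ^ 3"
    by (simp flip: power_mult)
  hence theta: "alt_theta ^ 24 = ramamani_Q ^ 3"
    by (simp only: alt_theta_power_8)
  \<comment> \<open>64 G5^2 = Q^2 W^2, and subtracting 64 \<open>delta\<close> leaves Q^3.\<close>
  have 1: "64 * (G5 * G5 - delta) = alt_theta ^ 24"
    using G(1) delta_eq theta by algebra
  \<comment> \<open>512 G3 G7 = 9 Q^3 + 8 Q^2 W^2 and 512 \<open>delta\<close> = 8 Q^2 W^2 - 8 Q^3,
    which explains the 17.\<close>
  have 2: "512 * (G3 * G7 - delta) = 17 * alt_theta ^ 24"
    using G(2,3) delta_eq theta by algebra
  have "64 * (fps_nth (G5 * G5) n - real_of_int (ramanujan_tau n)) = (-1) ^ n * real (sum_squares_count 24 n)"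
    using arg_cong[OF 1, of "\<lambda>f. fps_nth f n"]
    by (simp add: fps_numeral_mult_nth alt_theta_power_nth delta_def)
  moreover have "512 * (fps_nth (G3 * G7) n - real_of_int (ramanujan_tau n)) =
      17 * ((-1) ^ n * real (sum_squares_count 24 n))"
    using arg_cong[OF 2, of "\<lambda>f. fps_nth f n"]
    by (simp add: fps_numeral_mult_nth alt_theta_power_nth delta_def)
  ultimately show ?thesis
    unfolding sum_sigma_star_conv G3_def[symmetric] G5_def[symmetric] G7_def[symmetric]
    by (cases "even n") auto
qed

end
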